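(* Let $n,r\geq 2$ be integers, let $K$ be a field, let $S=K[x_1,\ldots,x_{n+r-1}]$ and let $I_{n,r}=x_1x_2\cdots x_{r-1}(x_r,x_{r+1},\ldots,x_{r+n-1})\subset S$. Then $$\operatorname{hdepth}(S/I_{n,r})\geq \left\lfloor \frac{n}{2}\right\rfloor+r-2.$$
   Context: $S$ carries the standard grading. For a finitely generated graded $S$-module $M$, the Hilbert depth $\operatorname{hdepth}(M)$ is the maximal depth of a finitely generated graded $S$-module $U$ having the same Hilbert series as $M$. The ideal $I_{n,r}$ is the squarefree monomial ideal generated by the $n$ monomials $x_1\cdots x_{r-1}x_{i}$, $r\leq i\leq r+n-1$. *)

theory Defs
  imports
    "HOL-Algebra.Ideal"
    "HOL-Computational_Algebra.Formal_Laurent_Series"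
    "HOL-Library.Poly_Mapping"
    "HOL-Library.Extended_Nat"
    "Jordan_Normal_Form.VS_Connect"
begin

type_synonym 'k mpoly = "(nat \<Rightarrow>\<^sub>0 nat) \<Rightarrow>\<^sub>0 'k"

definition Const :: "'k::zero \<Rightarrow> 'k mpoly" where
  "Const c = Poly_Mapping.single 0 c"

definition Var :: "nat \<Rightarrow> 'k::zero_neq_one mpoly" where
  "Var i = Poly_Mapping.single (Poly_Mapping.single i 1) 1"

definition poly_ring :: "nat \<Rightarrow> 'k::field mpoly ring" where
  "poly_ring N =
    \<lparr>carrier = {p. \<forall>a\<in>Poly_Mapping.keys p. Poly_Mapping.keys a \<subseteq> {1..N}}, monoid.mult = (*), one = 1, zero = 0, add = (+)\<rparr>"

definition total_degree :: "(nat \<Rightarrow>\<^sub>0 nat) \<Rightarrow> nat" where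
  "total_degree a = (\<Sum>i\<in>Poly_Mapping.keys a. Poly_Mapping.lookup a i)"

text \<open>Gradings are indexed by all integers; the negative components of the polynomial ring
  are \<open>{0}\<close>.\<close>

definition homogeneous_part :: "nat \<Rightarrow> int \<Rightarrow> 'k::field mpoly set" where
  "homogeneous_part N d = {p \<in> carrier (poly_ring N). \<forall>a\<in>Poly_Mapping.keys p. int (total_degree a) = d}"

definition max_ideal :: "nat \<Rightarrow> 'k::field mpoly set" where
  "max_ideal N = Idl\<^bsub>poly_ring N\<^esub> (Var ` {1..N})"

text \<open>The fields \<open>mult\<close> and \<open>one\<close> of module records play no role in \<^locale>\<open>Module.module\<close>.\<close>

definition self_module :: "'a ring \<Rightarrow> ('a, 'a) module" where
  "self_module R = \<lparr>carrier = carrier R, monoid.mult = monoid.mult R, one = one R,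
    zero = zero R, add = add R, smult = monoid.mult R\<rparr>"

definition quotient_module :: "('a, 'b) module \<Rightarrow> 'b set \<Rightarrow> ('a, 'b set) module" where
  "quotient_module M N = \<lparr>carrier = a_rcosets\<^bsub>M\<^esub> N, monoid.mult = undefined, one = undefined,
    zero = N, add = set_add M, smult = (\<lambda>a A. \<Union>u\<in>A. N +>\<^bsub>M\<^esub> (a \<odot>\<^bsub>M\<^esub> u))\<rparr>"

definition finitely_generated :: "'a ring \<Rightarrow> ('a, 'b) module \<Rightarrow> bool" where
  "finitely_generated R M \<longleftrightarrow>
    (\<exists>B. finite B \<and> B \<subseteq> carrier M \<and> LinearCombinations.module.span R M B = carrier M)"

text \<open>The submodule \<open>(f\<^sub>1, \<dots>, f\<^sub>k) M\<close> for \<open>fs = [f\<^sub>1, \<dots>, f\<^sub>k]\<close>.\<close>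

definition list_smult :: "'a ring \<Rightarrow> 'a list \<Rightarrow> ('a, 'b) module \<Rightarrow> 'b set" where
  "list_smult R fs M =
    LinearCombinations.module.span R M {f \<odot>\<^bsub>M\<^esub> u | f u. f \<in> set fs \<and> u \<in> carrier M}"

definition regular_element :: "('a, 'b) module \<Rightarrow> 'a \<Rightarrow> bool" where
  "regular_element M f \<longleftrightarrow> (\<forall>u\<in>carrier M. f \<odot>\<^bsub>M\<^esub> u = \<zero>\<^bsub>M\<^esub> \<longrightarrow> u = \<zero>\<^bsub>M\<^esub>)"

definition regular_sequence :: "'a ring \<Rightarrow> ('a, 'b) module \<Rightarrow> 'a list \<Rightarrow> bool" where
  "regular_sequence R M fs \<longleftrightarrow>
    set fs \<subseteq> carrier R \<and>
    (\<forall>i<length fs. regular_element (quotient_module M (list_smult R (take i fs) M)) (fs ! i)) \<and>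
    list_smult R fs M \<noteq> carrier M"

text \<open>Depth with respect to the graded maximal ideal.  The zero module has no regular sequence
  in the above sense, so that its depth is \<open>0\<close> here.\<close>

definition depth :: "nat \<Rightarrow> ('k::field mpoly, 'b) module \<Rightarrow> enat" where
  "depth N M = Sup {enat (length fs) | fs.
    set fs \<subseteq> max_ideal N \<and> regular_sequence (poly_ring N) M fs}"

definition graded_module ::
    "nat \<Rightarrow> ('k::field mpoly, 'b) module \<Rightarrow> (int \<Rightarrow> 'b set) \<Rightarrow> bool" where
  "graded_module N M G \<longleftrightarrow>
    Module.module (poly_ring N) M \<and>
    (\<forall>d. additive_subgroup (G d) M) \<and>
    (\<forall>u\<in>carrier M. \<exists>!c. (\<forall>d. c d \<in> G d) \<and> finite {d. c d \<noteq> \<zero>\<^bsub>M\<^esub>} \<and>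
      u = finsum M c {d. c d \<noteq> \<zero>\<^bsub>M\<^esub>}) \<and>
    (\<forall>i d. \<forall>p\<in>homogeneous_part N i. \<forall>u\<in>G d. p \<odot>\<^bsub>M\<^esub> u \<in> G (i + d))"

definition quotient_grading ::
    "('a, 'b) module \<Rightarrow> (int \<Rightarrow> 'b set) \<Rightarrow> 'b set \<Rightarrow> int \<Rightarrow> 'b set set" where
  "quotient_grading M G N d = (\<lambda>u. N +>\<^bsub>M\<^esub> u) ` G d"

text \<open>A homogeneous component as a vector space over the field of coefficients.\<close>

definition component ::
    "('k::field mpoly, 'b) module \<Rightarrow> (int \<Rightarrow> 'b set) \<Rightarrow> int \<Rightarrow> ('k, 'b) module" where
  "component M G d = \<lparr>carrier = G d, monoid.mult = monoid.mult M, one = one M,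
    zero = zero M, add = add M, smult = (\<lambda>c u. Const c \<odot>\<^bsub>M\<^esub> u)\<rparr>"

text \<open>For a finitely generated graded module all components are finite-dimensional and vanish in
  sufficiently small degrees, so the coefficients below do form a Laurent series.\<close>

definition hilbert_series ::
    "('k::field mpoly, 'b) module \<Rightarrow> (int \<Rightarrow> 'b set) \<Rightarrow> int fls" where
  "hilbert_series M G = Abs_fls (\<lambda>d. int (vectorspace.dim class_ring (component M G d)))"

text \<open>In the definition of the Hilbert depth, the module \<open>U\<close> ranges over all finitely generated
  graded modules up to isomorphism: such a module is a quotient of \<open>S\<^sup>k\<close> for some \<open>k\<close>, and hence
  has an isomorphic copy whose elements are sets of vectors (\<^typ>\<open>nat \<Rightarrow> 'k mpoly\<close>) of polynomials.
  If \<open>M \<noteq> 0\<close>, all depths involved are at most \<open>N\<close>, so the supremum is a maximum.\<close>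

definition hdepth ::
    "nat \<Rightarrow> ('k::field mpoly, 'b) module \<Rightarrow> (int \<Rightarrow> 'b set) \<Rightarrow> enat" where
  "hdepth N M G = Sup {depth N U | (U :: ('k mpoly, (nat \<Rightarrow> 'k mpoly) set) module) H.
    graded_module N U H \<and> finitely_generated (poly_ring N) U \<and>
    hilbert_series U H = hilbert_series M G}"

definition I_ideal :: "nat \<Rightarrow> nat \<Rightarrow> 'k::field mpoly set" where
  "I_ideal n r = Idl\<^bsub>poly_ring (n + r - 1)\<^esub> {(\<Prod>j=1..r-1. Var j) * Var i | i. i \<in> {r..r+n-1}}"

end

theory Submission
  imports Defs
begin

text \<open>
  With \<open>N = n + r - 1\<close>, the Hilbert series of \<open>S/I\<close> is
  \<open>1 / (1 - t)\<^sup>N - t\<^sup>r\<^sup>-\<^sup>1 / (1 - t)\<^sup>N + t\<^sup>r\<^sup>-\<^sup>1 / (1 - t)\<^sup>r\<^sup>-\<^sup>1\<close>: a monomial lies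
  outside \<open>I\<close> iff it is not divisible by \<open>x\<^sub>1 \<cdots> x\<^bsub>r-1\<^esub>\<close> or involves only
  \<open>x\<^sub>1, \<dots>, x\<^bsub>r-1\<^esub>\<close>.  It equals
  \<open>1 / (1 - t)\<^bsup>N-1\<^esup> + t\<^sup>r\<^sup>-\<^sup>1 / (1 - t)\<^sup>r\<^sup>-\<^sup>1\<close> plus the terms \<open>t\<^sup>i / (1 - t)\<^bsup>N-1\<^esup>\<close> for
  \<open>0 < i < r - 1\<close>.  Put \<open>d = n div 2 + r - 2\<close>.  Repeatedly splitting
  \<open>1 / (1 - t)\<^sup>k = 1 / (1 - t)\<^bsup>k-1\<^esup> + t / (1 - t)\<^sup>k\<close> rewrites the first two terms as a finite sum of
  \<open>t\<^sup>s / (1 - t)\<^sup>k\<close> with \<open>d \<le> k \<le> N\<close>.  Then \<open>S/I\<close> has the same Hilbert series as the direct sum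
  of the modules \<open>K[x\<^sub>1, \<dots>, x\<^sub>k](-s)\<close>, on which \<open>x\<^sub>1, \<dots>, x\<^sub>d\<close> is a regular sequence.
\<close>

section \<open>Polynomials with prescribed monomials\<close>

text \<open>The \<open>K\<close>-span of the monomials with exponent in \<open>F\<close>. The ring,
  its homogeneous parts and monomial ideals all have this form, which reduces questions about them
  to sets of exponents.\<close>

definition supported :: "(nat \<Rightarrow>\<^sub>0 nat) set \<Rightarrow> 'k::zero mpoly set" where
  "supported F = {p. Poly_Mapping.keys p \<subseteq> F}"

definition restriction :: "(nat \<Rightarrow>\<^sub>0 nat) set \<Rightarrow> 'k::comm_monoid_add mpoly \<Rightarrow> 'k mpoly" where
  "restriction F p =
    (\<Sum>a\<in>Poly_Mapping.keys p \<inter> F. Poly_Mapping.single a (Poly_Mapping.lookup p a))"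

text \<open>Index 0 stays free, so \<open>x_0\<close> can later label the summands of a direct
  sum.\<close>

definition monomials :: "nat \<Rightarrow> (nat \<Rightarrow>\<^sub>0 nat) set" where
  "monomials N = {a. Poly_Mapping.keys a \<subseteq> {1..N}}"

lemma supportedD: "p \<in> supported F \<Longrightarrow> a \<notin> F \<Longrightarrow> Poly_Mapping.lookup p a = 0"
  by (auto simp: supported_def in_keys_iff)

lemma supportedI: "(\<And>a. Poly_Mapping.lookup p a \<noteq> 0 \<Longrightarrow> a \<in> F) \<Longrightarrow> p \<in> supported F"
  by (auto simp: supported_def in_keys_iff)

lemma lookup_restriction:
  "Poly_Mapping.lookup (restriction F p) a = (if a \<in> F then Poly_Mapping.lookup p a else 0)"
proof -
  have "Poly_Mapping.lookup (restriction F p) a =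
      (\<Sum>b\<in>Poly_Mapping.keys p \<inter> F. if b = a then Poly_Mapping.lookup p a else 0)"
    unfolding restriction_def lookup_sum
    by (intro sum.cong) (auto simp: lookup_single when_def)
  also have "\<dots> = (if a \<in> F then Poly_Mapping.lookup p a else 0)"
    by (simp add: sum.delta in_keys_iff)
  finally show ?thesis .
qed

lemma restriction_supported: "restriction F p \<in> supported F"
  by (rule supportedI) (auto simp: lookup_restriction split: if_splits)

lemma restriction_in_supported: "p \<in> supported G \<Longrightarrow> restriction F p \<in> supported (F \<inter> G)"
  by (rule supportedI) (auto simp: lookup_restriction dest: supportedD split: if_splits)

lemma restriction_id: "p \<in> supported F \<Longrightarrow> restriction F p = p"
  by (rule poly_mapping_eqI) (auto simp: lookup_restriction supportedD)

lemma restriction_add: "restriction F (p + q) = restriction F p + restriction F q"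
  by (rule poly_mapping_eqI) (auto simp: lookup_restriction lookup_add)

lemma restriction_disjoint: "p \<in> supported G \<Longrightarrow> F \<inter> G = {} \<Longrightarrow> restriction F p = 0"
  by (rule poly_mapping_eqI) (auto simp: lookup_restriction dest: supportedD)

lemma supported_zero [simp]: "0 \<in> supported F"
  by (simp add: supported_def)

lemma supported_single: "a \<in> F \<Longrightarrow> Poly_Mapping.single a c \<in> supported F"
  by (simp add: supported_def)

lemma supported_add: "p \<in> supported F \<Longrightarrow> q \<in> supported F \<Longrightarrow> p + q \<in> supported F"
  using keys_add[of p q] by (auto simp: supported_def)

lemma supported_uminus: "(p :: 'k::ab_group_add mpoly) \<in> supported F \<Longrightarrow> - p \<in> supported F"
  by (rule supportedI) (auto dest: supportedD)

lemma supported_diff: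
  "(p :: 'k::ab_group_add mpoly) \<in> supported F \<Longrightarrow> q \<in> supported F \<Longrightarrow> p - q \<in> supported F"
  using supported_add[OF _ supported_uminus, of p F q] by simp

lemma supported_mono: "p \<in> supported F \<Longrightarrow> F \<subseteq> G \<Longrightarrow> p \<in> supported G"
  by (auto simp: supported_def)

lemma supported_mult:
  assumes "p \<in> supported F" "q \<in> supported G" "\<And>a b. a \<in> F \<Longrightarrow> b \<in> G \<Longrightarrow> a + b \<in> H"
  shows "p * q \<in> supported H"
  using assms keys_mult[of p q] by (fastforce simp: supported_def)

lemma supported_induct [consumes 1, case_names zero add]:
  fixes p :: "'k::comm_monoid_add mpoly"
  assumes "p \<in> supported F"
    and zero: "P 0"
    and add: "\<And>a c p. a \<in> F \<Longrightarrow> p \<in> supported F \<Longrightarrow> P p \<Longrightarrow> P (Poly_Mapping.single a c + p)"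
  shows "P p"
proof -
  have "P (\<Sum>a\<in>A. Poly_Mapping.single a (Poly_Mapping.lookup p a)) \<and>
      (\<Sum>a\<in>A. Poly_Mapping.single a (Poly_Mapping.lookup p a)) \<in> supported F"
    if "finite A" "A \<subseteq> F" for A
    using that
    by (induction A) (auto simp: zero intro: add supported_add supported_single)
  from this[of "Poly_Mapping.keys p \<inter> F"] have "P (restriction F p)"
    by (simp add: restriction_def)
  with assms(1) show ?thesis by (simp add: restriction_id)
qed

text \<open>Translation by \<open>a\<close> is injective on exponents, so only the term of
  \<open>p\<close> at \<open>b\<close> contributes.\<close>

lemma mult_single_lookup_plus:
  "Poly_Mapping.lookup (Poly_Mapping.single a c * p) (a + b) = c * Poly_Mapping.lookup p b"
  for a :: "nat \<Rightarrow>\<^sub>0 nat" and p :: "'k::comm_ring_1 mpoly"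
proof -
  have "p \<in> supported UNIV" by (simp add: supported_def)
  then show ?thesis
    by (induction p rule: supported_induct)
      (auto simp: distrib_left mult_single lookup_add lookup_single when_def)
qed

lemma Const_mult_single:
  "Const c * Poly_Mapping.single a x = Poly_Mapping.single a (c * x :: 'k::comm_ring_1)"
  by (simp add: Const_def mult_single)

lemma lookup_Const_mult:
  "Poly_Mapping.lookup (Const c * p) a = (c :: 'k::comm_ring_1) * Poly_Mapping.lookup p a"
  using mult_single_lookup_plus[of 0 c p a] by (simp add: Const_def)

lemma Const_add: "Const (a + b) = Const a + (Const b :: 'k::comm_ring_1 mpoly)"
  by (simp add: Const_def single_add)

lemma Const_mult: "Const (a * b) = Const a * (Const b :: 'k::comm_ring_1 mpoly)"
  by (simp add: Const_def mult_single)

lemma Const_one: "Const (1 :: 'k::comm_ring_1) = 1"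
  by (simp add: Const_def)

lemma Const_mult_supported: "p \<in> supported F \<Longrightarrow> Const (c :: 'k::comm_ring_1) * p \<in> supported F"
  by (rule supportedI) (auto simp: lookup_Const_mult dest: supportedD)

text \<open>Subtraction of exponents is truncated at 0; the hypothesis makes it exact.\<close>

lemma single_add_diff:
  assumes "Poly_Mapping.lookup a j \<noteq> 0"
  shows "Poly_Mapping.single j 1 + (a - Poly_Mapping.single j 1) = (a :: nat \<Rightarrow>\<^sub>0 nat)"
  using assms by (intro poly_mapping_eqI) (auto simp: lookup_add lookup_minus lookup_single when_def)

section \<open>Exponents of monomials and their degrees\<close>

lemma monomials_zero [simp]: "0 \<in> monomials N"
  by (simp add: monomials_def)

text \<open>Natural exponents cannot cancel; hence monomials in \<open>x_1, ..., x_N\<close> are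
  closed under divisors as well as products.\<close>

lemma keys_add_nat: "Poly_Mapping.keys (a + b) = Poly_Mapping.keys a \<union> Poly_Mapping.keys (b :: nat \<Rightarrow>\<^sub>0 nat)"
  by (auto simp: in_keys_iff lookup_add)

lemma monomials_add_iff: "a + b \<in> monomials N \<longleftrightarrow> a \<in> monomials N \<and> b \<in> monomials N"
  by (auto simp: monomials_def keys_add_nat)

lemma total_degree_superset:
  "finite A \<Longrightarrow> Poly_Mapping.keys a \<subseteq> A \<Longrightarrow> total_degree a = (\<Sum>i\<in>A. Poly_Mapping.lookup a i)"
  unfolding total_degree_def by (rule sum.mono_neutral_left) (auto simp: in_keys_iff)

lemma total_degree_add: "total_degree (a + b) = total_degree a + total_degree b"
  using total_degree_superset[of "Poly_Mapping.keys a \<union> Poly_Mapping.keys b"]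
  by (simp add: keys_add_nat lookup_add sum.distrib)

lemma total_degree_single: "total_degree (Poly_Mapping.single i m) = m"
  by (simp add: total_degree_def)

section \<open>The polynomial ring and its graded parts as spans of monomials\<close>

lemma carrier_poly_ring: "carrier (poly_ring N) = supported (monomials N)"
  by (auto simp: poly_ring_def supported_def monomials_def)

lemma poly_ring_simps:
  "monoid.mult (poly_ring N) = (*)" "one (poly_ring N) = 1" "zero (poly_ring N) = 0"
  "add (poly_ring N) = (+)"
  by (simp_all add: poly_ring_def)

lemma supported_one: "1 \<in> supported (monomials N)"
  by (simp add: supported_def)

lemma supported_monomials_mult:
  "p \<in> supported (monomials N) \<Longrightarrow> q \<in> supported (monomials N) \<Longrightarrow>
    p * q \<in> supported (monomials N)"
  by (rule supported_mult) (simp_all add: monomials_add_iff)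

lemma Var_in_poly_ring: "i \<in> {1..N} \<Longrightarrow> Var i \<in> supported (monomials N)"
  by (simp add: Var_def supported_single monomials_def)

lemma cring_poly_ring: "cring (poly_ring N :: 'k::field mpoly ring)"
  by (intro cringI abelian_groupI Group.comm_monoidI)
    (auto simp: poly_ring_simps carrier_poly_ring supported_add supported_monomials_mult supported_one algebra_simps
      intro: bexI[OF _ supported_uminus])

lemma homogeneous_part_eq:
  "homogeneous_part N d = supported {a \<in> monomials N. int (total_degree a) = d}"
  by (auto simp: homogeneous_part_def carrier_poly_ring supported_def)

text \<open>Since \<open>\<psi>\<close> is linear and injective on the span, the images of the
  monomials in \<open>F\<close> form a basis. A general \<open>\<psi>\<close> covers both the
  modules built below and cosets modulo a monomial ideal.\<close>

lemma dim_monomial_basis: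
  fixes V :: "('k::field, 'b) module" and \<psi> :: "'k mpoly \<Rightarrow> 'b"
  assumes finF: "finite F" and carrier: "carrier V = \<psi> ` supported F"
    and inj: "inj_on \<psi> (supported F)" and zero: "\<zero>\<^bsub>V\<^esub> = \<psi> 0"
    and add: "\<And>p q. p \<in> supported F \<Longrightarrow> q \<in> supported F \<Longrightarrow> \<psi> p \<oplus>\<^bsub>V\<^esub> \<psi> q = \<psi> (p + q)"
    and smult: "\<And>c p. p \<in> supported F \<Longrightarrow> c \<odot>\<^bsub>V\<^esub> \<psi> p = \<psi> (Const c * p)"
  shows "vectorspace.dim class_ring V = card F"
proof -
  have grp: "abelian_group V"
  proof (rule abelian_groupI)
    fix x assume "x \<in> carrier V"
    then obtain p where p: "p \<in> supported F" "x = \<psi> p" by (auto simp: carrier)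
    then have "\<psi> (- p) \<oplus>\<^bsub>V\<^esub> x = \<zero>\<^bsub>V\<^esub>" by (simp add: add supported_uminus zero)
    with p show "\<exists>y\<in>carrier V. y \<oplus>\<^bsub>V\<^esub> x = \<zero>\<^bsub>V\<^esub>" by (auto simp: carrier supported_uminus)
  qed (auto simp: carrier add zero supported_add add_ac)
  have "Module.module class_ring V"
  proof (rule moduleI)
    show "cring (class_ring :: 'k ring)" by (rule class_cring.cring_axioms)
  qed (use grp in \<open>auto simp: carrier add smult Const_mult_supported supported_add
        Const_add Const_mult Const_one distrib_left distrib_right mult.assoc\<close>)
  then interpret vectorspace class_ring V
    unfolding vectorspace_def using class_field by blast
  define b where "b = (\<lambda>a. \<psi> (Poly_Mapping.single a 1))"
  have b_inj: "inj_on b F"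
    unfolding b_def
  proof (rule inj_onI)
    fix x y assume "x \<in> F" "y \<in> F" "\<psi> (Poly_Mapping.single x 1) = \<psi> (Poly_Mapping.single y 1)"
    then have "Poly_Mapping.single x (1 :: 'k) = Poly_Mapping.single y 1"
      by (intro inj_onD[OF inj]) (simp_all add: supported_single)
    then show "x = y" by (metis lookup_single_eq lookup_single_not_eq zero_neq_one)
  qed
  have b_carrier: "b ` F \<subseteq> carrier V"
    by (auto simp: b_def carrier supported_single)
  \<comment> \<open>A combination of basis vectors is the image of the polynomial with the same
    coefficients; independence and spanning are then read off from \<open>lookup\<close>.\<close>
  have lincomb: "lincomb c (b ` G) = \<psi> (\<Sum>a\<in>G. Poly_Mapping.single a (c (b a)))"
    and sum_supported: "(\<Sum>a\<in>G. Poly_Mapping.single a (c (b a))) \<in> supported F"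
    if "G \<subseteq> F" for c G
  proof -
    have "finite G" using that finF by (rule finite_subset)
    have "finsum V (\<lambda>v. c v \<odot>\<^bsub>V\<^esub> v) (b ` G) = \<psi> (\<Sum>a\<in>G. Poly_Mapping.single a (c (b a))) \<and>
        (\<Sum>a\<in>G. Poly_Mapping.single a (c (b a))) \<in> supported F"
      using \<open>finite G\<close> that
    proof (induction G)
      case empty
      then show ?case by (simp add: zero)
    next
      case (insert a G)
      have notin: "b a \<notin> b ` G"
        using inj_onD[OF b_inj] insert by auto
      have closed: "(\<lambda>v. c v \<odot>\<^bsub>V\<^esub> v) \<in> b ` G \<rightarrow> carrier V" "c (b a) \<odot>\<^bsub>V\<^esub> b a \<in> carrier V"
        using b_carrier insert.prems by (auto intro!: smult_closed)
      have "c (b a) \<odot>\<^bsub>V\<^esub> b a = \<psi> (Poly_Mapping.single a (c (b a)))"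
        using insert.prems by (simp add: b_def smult supported_single Const_mult_single)
      with insert notin closed show ?case
        by (simp add: add supported_single supported_add)
    qed
    then show "lincomb c (b ` G) = \<psi> (\<Sum>a\<in>G. Poly_Mapping.single a (c (b a)))"
      "(\<Sum>a\<in>G. Poly_Mapping.single a (c (b a))) \<in> supported F"
      by (auto simp: lincomb_def)
  qed
  have lookup: "Poly_Mapping.lookup (\<Sum>a\<in>G. Poly_Mapping.single a (f a)) x =
      (if x \<in> G then f x else 0)" if "G \<subseteq> F" for G x and f :: "(nat \<Rightarrow>\<^sub>0 nat) \<Rightarrow> 'k"
    using finite_subset[OF that finF]
    by (simp add: lookup_sum lookup_single when_def sum.delta)
  have "lin_indpt (b ` F)"
  proof
    assume "lin_dep (b ` F)"
    then obtain A c v where A: "A \<subseteq> b ` F" "lincomb c A = \<zero>\<^bsub>V\<^esub>" "v \<in> A" "c v \<noteq> 0"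
      unfolding lin_dep_def by auto
    then obtain G where G: "G \<subseteq> F" "A = b ` G" by (auto simp: subset_image_iff)
    with A obtain x where x: "x \<in> G" "c (b x) \<noteq> 0" by auto
    have "\<psi> (\<Sum>a\<in>G. Poly_Mapping.single a (c (b a))) = \<psi> 0"
      using A G lincomb by (simp add: zero)
    then have "(\<Sum>a\<in>G. Poly_Mapping.single a (c (b a))) = 0"
      using inj_onD[OF inj] sum_supported[OF G(1)] by auto
    with lookup[OF G(1), of "\<lambda>a. c (b a)" x] x show False by simp
  qed
  moreover have "carrier V \<subseteq> span (b ` F)"
  proof
    fix x assume "x \<in> carrier V"
    then obtain p where p: "p \<in> supported F" "x = \<psi> p" by (auto simp: carrier)
    \<comment> \<open>Coefficient functions take vectors as arguments, so the exponent is recovered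
      by inverting \<open>b\<close>.\<close>
    define c where "c = (\<lambda>v. Poly_Mapping.lookup p (the_inv_into F b v))"
    have "(\<Sum>a\<in>F. Poly_Mapping.single a (c (b a))) = p"
      by (rule poly_mapping_eqI)
        (use p in \<open>auto simp: lookup c_def the_inv_into_f_f[OF b_inj] supportedD\<close>)
    with lincomb[of F c] p have "x = lincomb c (b ` F)" by simp
    then show "x \<in> span (b ` F)"
      unfolding span_def using finF by auto
  qed
  then have "gen_set (b ` F)"
    using span_is_subset2[OF b_carrier] by auto
  ultimately have "basis (b ` F)"
    using b_carrier by (simp add: basis_def)
  then have "dim = card (b ` F)"
    using finF by (intro dim_basis) auto
  then show ?thesis using b_inj by (simp add: card_image)
qed

section \<open>Modules with a monomial basis\<close>

text \<open>The module with \<open>K\<close>-basis \<open>B\<close> on which a product of monomials that leaves \<open>B\<close> is zero.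
  The monomials in \<open>B\<close> may involve further variables besides \<open>x\<^sub>1, \<dots>, x\<^sub>N\<close>; these label generators.
  The injection \<open>\<phi>\<close> only transports the module to the element type that \<^const>\<open>hdepth\<close>
  prescribes.\<close>

locale monomial_module =
  fixes N :: nat and B :: "(nat \<Rightarrow>\<^sub>0 nat) set" and \<delta> :: "(nat \<Rightarrow>\<^sub>0 nat) \<Rightarrow> int"
    and \<phi> :: "'k::field mpoly \<Rightarrow> 'b"
  assumes inj_phi: "inj \<phi>"
    and B_closed: "\<And>a b. a \<in> monomials N \<Longrightarrow> a + b \<in> B \<Longrightarrow> b \<in> B"
    and degree_add: "\<And>a b. a \<in> monomials N \<Longrightarrow> \<delta> (a + b) = int (total_degree a) + \<delta> b"
begin

definition M :: "('k mpoly, 'b) module" where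
  "M = \<lparr>carrier = \<phi> ` supported B, monoid.mult = undefined, one = undefined, zero = \<phi> 0,
    add = (\<lambda>u v. \<phi> (the_inv \<phi> u + the_inv \<phi> v)),
    smult = (\<lambda>p u. \<phi> (restriction B (p * the_inv \<phi> u)))\<rparr>"

definition G :: "int \<Rightarrow> 'b set" where
  "G d = \<phi> ` supported {b \<in> B. \<delta> b = d}"

lemma phi_eq_iff [simp]: "\<phi> p = \<phi> q \<longleftrightarrow> p = q"
  by (simp add: inj_phi inj_eq)

lemma M_simps:
  "carrier M = \<phi> ` supported B" "\<zero>\<^bsub>M\<^esub> = \<phi> 0" "\<phi> p \<oplus>\<^bsub>M\<^esub> \<phi> q = \<phi> (p + q)"
  "r \<odot>\<^bsub>M\<^esub> \<phi> p = \<phi> (restriction B (r * p))"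
  by (simp_all add: M_def the_inv_f_f[OF inj_phi])

lemma phi_in_image: "\<phi> p \<in> \<phi> ` supported F \<longleftrightarrow> p \<in> supported F"
  by auto

text \<open>By \<open>B_closed\<close>, exponents outside \<open>B\<close> stay outside under
  multiplication by the ring, so terms may be discarded before or after multiplying. This makes the
  action associative.\<close>

lemma restriction_mult_restriction:
  fixes p q :: "'k mpoly"
  assumes "p \<in> supported (monomials N)"
  shows "restriction B (p * restriction B q) = restriction B (p * q)"
proof -
  have "q - restriction B q \<in> supported (- B)"
    by (rule supportedI) (auto simp: lookup_minus lookup_restriction)
  then have "p * (q - restriction B q) \<in> supported (- B)"
    using assms by (intro supported_mult[of p _ "_ - _"]) (auto dest: B_closed)
  then have "restriction B (p * (q - restriction B q)) = 0"
    by (rule restriction_disjoint) simp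
  then have "restriction B (p * restriction B q + p * (q - restriction B q)) =
      restriction B (p * restriction B q)"
    by (simp only: restriction_add) simp
  then show ?thesis by (simp add: algebra_simps)
qed

lemma abelian_group_M: "abelian_group M"
proof (rule abelian_groupI)
  fix x assume "x \<in> carrier M"
  then obtain p where p: "p \<in> supported B" "x = \<phi> p" by (auto simp: M_simps)
  then have "\<phi> (- p) \<oplus>\<^bsub>M\<^esub> x = \<zero>\<^bsub>M\<^esub>" by (simp add: M_simps)
  with p show "\<exists>y\<in>carrier M. y \<oplus>\<^bsub>M\<^esub> x = \<zero>\<^bsub>M\<^esub>"
    by (intro bexI[of _ "\<phi> (- p)"]) (simp_all add: M_simps supported_uminus)
qed (auto simp: M_simps supported_add add_ac)

lemma module_M: "Module.module (poly_ring N) M"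
proof (rule moduleI)
  show "cring (poly_ring N :: 'k mpoly ring)" by (rule cring_poly_ring)
  show "abelian_group M" by (rule abelian_group_M)
qed (auto simp: M_simps poly_ring_simps carrier_poly_ring restriction_supported distrib_left
    distrib_right restriction_add restriction_id mult.assoc restriction_mult_restriction)

sublocale Module.module "poly_ring N" M
  by (rule module_M)

section \<open>The grading of a monomial module\<close>

lemma finsum_phi:
  "finite A \<Longrightarrow> (\<And>i. i \<in> A \<Longrightarrow> f i \<in> supported B) \<Longrightarrow>
    finsum M (\<lambda>i. \<phi> (f i)) A = \<phi> (sum f A)"
proof (induction A rule: finite_induct)
  case empty
  then show ?case by (simp add: M_simps)
next
  case (insert i A)
  then show ?case
    by (subst finsum_insert) (auto simp: M_simps)
qed

text \<open>The summands have disjoint supports: the exponent \<open>a\<close> can occur only in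
  degree \<open>\<delta> a\<close>.\<close>

lemma lookup_sum_graded:
  assumes f: "\<And>d. f d \<in> supported {b \<in> B. \<delta> b = d}" and fin: "finite {d. f d \<noteq> 0}"
  shows "Poly_Mapping.lookup (sum f {d. f d \<noteq> 0}) a = Poly_Mapping.lookup (f (\<delta> a)) a"
proof -
  have "Poly_Mapping.lookup (sum f {d. f d \<noteq> 0}) a =
      (\<Sum>d\<in>{d. f d \<noteq> 0}. if d = \<delta> a then Poly_Mapping.lookup (f d) a else 0)"
    unfolding lookup_sum by (intro sum.cong refl) (use supportedD[OF f] in auto)
  also have "\<dots> = Poly_Mapping.lookup (f (\<delta> a)) a"
    using fin by (auto simp: sum.delta)
  finally show ?thesis .
qed

lemma graded_decomposition:
  assumes p: "p \<in> supported B"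
  shows "\<exists>!c. (\<forall>d. c d \<in> G d) \<and> finite {d. c d \<noteq> \<zero>\<^bsub>M\<^esub>} \<and>
      \<phi> p = finsum M c {d. c d \<noteq> \<zero>\<^bsub>M\<^esub>}"
proof
  define f where "f = (\<lambda>d. restriction {b \<in> B. \<delta> b = d} p)"
  have f: "f d \<in> supported {b \<in> B. \<delta> b = d}" for d
    by (simp add: f_def restriction_supported)
  then have fB: "f d \<in> supported B" for d
    by (rule supported_mono) auto
  have "{d. f d \<noteq> 0} \<subseteq> \<delta> ` Poly_Mapping.keys p"
  proof
    fix d assume "d \<in> {d. f d \<noteq> 0}"
    then obtain a where "Poly_Mapping.lookup (f d) a \<noteq> 0"
      by (metis mem_Collect_eq lookup_zero poly_mapping_eqI)
    then show "d \<in> \<delta> ` Poly_Mapping.keys p"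
      by (auto simp: f_def lookup_restriction in_keys_iff split: if_splits)
  qed
  then have fin: "finite {d. f d \<noteq> 0}"
    by (rule finite_subset) simp
  have "p = sum f {d. f d \<noteq> 0}"
  proof (rule poly_mapping_eqI)
    show "Poly_Mapping.lookup p a = Poly_Mapping.lookup (sum f {d. f d \<noteq> 0}) a" for a
      unfolding lookup_sum_graded[OF f fin]
      using supportedD[OF p, of a] by (auto simp: f_def lookup_restriction)
  qed
  then show "(\<forall>d. \<phi> (f d) \<in> G d) \<and> finite {d. \<phi> (f d) \<noteq> \<zero>\<^bsub>M\<^esub>} \<and>
      \<phi> p = finsum M (\<lambda>d. \<phi> (f d)) {d. \<phi> (f d) \<noteq> \<zero>\<^bsub>M\<^esub>}"
    using f fB fin by (simp add: M_simps G_def phi_in_image finsum_phi)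
  fix c
  assume c: "(\<forall>d. c d \<in> G d) \<and> finite {d. c d \<noteq> \<zero>\<^bsub>M\<^esub>} \<and>
      \<phi> p = finsum M c {d. c d \<noteq> \<zero>\<^bsub>M\<^esub>}"
  \<comment> \<open>Uniqueness: any decomposition lifts along \<open>\<phi>\<close> to polynomials,
    whose coefficients are forced by \<open>lookup_sum_graded\<close>.\<close>
  then have "\<forall>d. \<exists>q. q \<in> supported {b \<in> B. \<delta> b = d} \<and> c d = \<phi> q"
    by (auto simp: G_def)
  from choice[OF this] obtain g where g: "\<And>d. g d \<in> supported {b \<in> B. \<delta> b = d}"
    and cg: "c = (\<lambda>d. \<phi> (g d))"
    by auto
  from g have "g d \<in> supported B" for d
    by (rule supported_mono) auto
  moreover have fin_g: "finite {d. g d \<noteq> 0}"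
    using c by (simp add: cg M_simps)
  ultimately have "finsum M (\<lambda>d. \<phi> (g d)) {d. g d \<noteq> 0} = \<phi> (sum g {d. g d \<noteq> 0})"
    by (intro finsum_phi)
  then have p_eq: "p = sum g {d. g d \<noteq> 0}"
    using c by (simp add: cg M_simps)
  have "f d = g d" for d
  proof (rule poly_mapping_eqI)
    fix a
    show "Poly_Mapping.lookup (f d) a = Poly_Mapping.lookup (g d) a"
      using supportedD[OF g, of a d] lookup_sum_graded[OF g fin_g, of a]
      by (auto simp: f_def lookup_restriction p_eq[symmetric])
  qed
  then show "c = (\<lambda>d. \<phi> (f d))" by (simp add: cg)
qed

lemma graded_module_M: "graded_module N M G"
  unfolding graded_module_def
proof (intro conjI allI ballI)
  show "additive_subgroup (G d) M" for d
  proof (intro additive_subgroup.intro group.subgroupI)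
    show "group (add_monoid M)"
      by (rule abelian_group.a_group[OF abelian_group_M])
    fix u assume "u \<in> G d"
    then obtain p where p: "u = \<phi> p" "p \<in> supported {b \<in> B. \<delta> b = d}" by (auto simp: G_def)
    then have "p \<in> supported B" by (auto simp: supported_def)
    with p have "\<ominus>\<^bsub>M\<^esub> u = \<phi> (- p)"
      by (intro minus_equality) (auto simp: M_simps phi_in_image supported_uminus)
    with p show "inv\<^bsub>add_monoid M\<^esub> u \<in> G d"
      by (simp add: a_inv_def G_def phi_in_image supported_uminus)
  next
    show "G d \<subseteq> carrier (add_monoid M)"
      by (auto simp: G_def M_simps supported_def)
    show "G d \<noteq> {}"
      by (auto simp: G_def intro: supported_zero)
  next
    fix u v assume "u \<in> G d" "v \<in> G d"
    then show "u \<otimes>\<^bsub>add_monoid M\<^esub> v \<in> G d"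
      by (auto simp: G_def M_simps phi_in_image supported_add)
  qed
next
  fix u assume "u \<in> carrier M"
  then obtain p where "p \<in> supported B" "u = \<phi> p" by (auto simp: M_simps)
  then show "\<exists>!c. (\<forall>d. c d \<in> G d) \<and> finite {d. c d \<noteq> \<zero>\<^bsub>M\<^esub>} \<and>
      u = finsum M c {d. c d \<noteq> \<zero>\<^bsub>M\<^esub>}"
    using graded_decomposition by simp
next
  fix i d and p :: "'k mpoly" and u
  assume p: "p \<in> homogeneous_part N i" and "u \<in> G d"
  then obtain q where q: "u = \<phi> q" "q \<in> supported {b \<in> B. \<delta> b = d}" by (auto simp: G_def)
  from p q have "p * q \<in> supported {b. \<delta> b = i + d}"
    unfolding homogeneous_part_eq by (elim supported_mult) (auto simp: degree_add)
  then have "restriction B (p * q) \<in> supported (B \<inter> {b. \<delta> b = i + d})"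
    by (rule restriction_in_supported)
  then show "p \<odot>\<^bsub>M\<^esub> u \<in> G (i + d)"
    by (simp add: q G_def M_simps phi_in_image Int_def)
qed (rule module_M)

lemma dim_component:
  assumes "finite {b \<in> B. \<delta> b = d}"
  shows "vectorspace.dim class_ring (component M G d) = card {b \<in> B. \<delta> b = d}"
proof (rule dim_monomial_basis[OF assms])
  fix c and p :: "'k mpoly"
  assume "p \<in> supported {b \<in> B. \<delta> b = d}"
  then have "p \<in> supported B" by (auto simp: supported_def)
  then show "c \<odot>\<^bsub>component M G d\<^esub> \<phi> p = \<phi> (Const c * p)"
    by (simp add: component_def M_simps restriction_id Const_mult_supported)
qed (auto simp: component_def M_simps G_def inj_on_def)

text \<open>Closure is only asked for products that stay in \<open>B\<close>, because all others
  vanish in \<open>M\<close>.\<close>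

lemma submodule_phi:
  assumes "C \<subseteq> B" "\<And>a b. a \<in> monomials N \<Longrightarrow> b \<in> C \<Longrightarrow> a + b \<in> B \<Longrightarrow> a + b \<in> C"
  shows "LinearCombinations.submodule (poly_ring N) (\<phi> ` supported C) M"
proof (unfold_locales)
  show "\<phi> ` supported C \<subseteq> carrier M"
    using assms(1) by (auto simp: M_simps phi_in_image elim: supported_mono)
  fix c :: "'k mpoly" and v assume c: "c \<in> carrier (poly_ring N)" and "v \<in> \<phi> ` supported C"
  then obtain q where q: "v = \<phi> q" "q \<in> supported C" by auto
  have "c * q \<in> supported {b. b \<in> B \<longrightarrow> b \<in> C}"
    using c q by (intro supported_mult[of c "monomials N" q C]) (auto simp: carrier_poly_ring assms)
  then have "restriction B (c * q) \<in> supported (B \<inter> {b. b \<in> B \<longrightarrow> b \<in> C})"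
    by (rule restriction_in_supported)
  then show "c \<odot>\<^bsub>M\<^esub> v \<in> \<phi> ` supported C"
    by (auto simp: q M_simps phi_in_image elim: supported_mono)
qed (auto simp: M_simps phi_in_image supported_add)

lemma phi_supported_subset_span:
  assumes S: "S \<subseteq> carrier M"
    and gen: "\<And>b c. b \<in> C \<Longrightarrow> \<exists>a u. a \<in> carrier (poly_ring N) \<and> u \<in> S \<and>
      \<phi> (Poly_Mapping.single b c) = a \<odot>\<^bsub>M\<^esub> u"
  shows "\<phi> ` supported C \<subseteq> span S"
proof -
  interpret span: LinearCombinations.submodule "poly_ring N" "span S" M
    by (rule span_is_submodule[OF S])
  have "\<phi> p \<in> span S" if "p \<in> supported C" for p
    using that
  proof (induction rule: supported_induct)
    case zero
    then show ?case using span.zero_closed by (simp add: M_simps)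
  next
    case (add b c p)
    from gen[OF add(1)] obtain a u where au: "a \<in> carrier (poly_ring N)" "u \<in> S"
      "\<phi> (Poly_Mapping.single b c) = a \<odot>\<^bsub>M\<^esub> u"
      by metis
    then have "\<phi> (Poly_Mapping.single b c) \<in> span S"
      unfolding au(3) using in_own_span[OF S] by (intro span.smult_closed) auto
    then have "\<phi> (Poly_Mapping.single b c) \<oplus>\<^bsub>M\<^esub> \<phi> p \<in> span S"
      using add by (intro span.m_closed)
    then show ?case by (simp add: M_simps)
  qed
  then show ?thesis by auto
qed

lemma finitely_generated_M:
  assumes "finite E" "E \<subseteq> B" "\<And>b. b \<in> B \<Longrightarrow> \<exists>a\<in>monomials N. \<exists>e\<in>E. b = a + e"
  shows "finitely_generated (poly_ring N) M"
  unfolding finitely_generated_def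
proof (intro exI conjI)
  let ?S = "(\<lambda>e. \<phi> (Poly_Mapping.single e 1)) ` E"
  show "finite ?S" using assms by simp
  show S: "?S \<subseteq> carrier M"
    using assms by (auto simp: M_simps phi_in_image supported_single)
  have "carrier M \<subseteq> span ?S"
    unfolding M_simps
  proof (rule phi_supported_subset_span[OF S])
    fix b c assume b: "b \<in> B"
    with assms obtain a e where ae: "a \<in> monomials N" "e \<in> E" "b = a + e" by blast
    show "\<exists>a u. a \<in> carrier (poly_ring N) \<and> u \<in> ?S \<and> \<phi> (Poly_Mapping.single b c) = a \<odot>\<^bsub>M\<^esub> u"
      using ae b
      by (intro exI[of _ "Poly_Mapping.single a c"] exI[of _ "\<phi> (Poly_Mapping.single e 1)"])
        (auto simp: M_simps carrier_poly_ring supported_single mult_single restriction_id)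
  qed
  then show "span ?S = carrier M"
    using span_is_subset2[OF S] by auto
qed

section \<open>The variables as a regular sequence\<close>

lemma coset_phi: "\<phi> ` supported C +>\<^bsub>M\<^esub> \<phi> p = (\<lambda>q. \<phi> (q + p)) ` supported C"
  by (auto simp: a_r_coset_def r_coset_def M_simps)

text \<open>Multiplying by \<open>x_j\<close> makes the exponent at \<open>j\<close> positive;
  conversely such an exponent in \<open>B\<close> is divisible by \<open>x_j\<close> with cofactor
  in \<open>B\<close>, by \<open>B_closed\<close>. All quotients along the sequence thus stay
  monomial.\<close>

lemma list_smult_variables:
  assumes "i \<le> N"
  shows "list_smult (poly_ring N) (map Var [1..<Suc i]) M =
    \<phi> ` supported {b \<in> B. \<exists>j\<in>{1..i}. Poly_Mapping.lookup b j \<noteq> 0}" (is "_ = \<phi> ` supported ?C")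
proof -
  let ?S = "{f \<odot>\<^bsub>M\<^esub> u | f u. f \<in> set (map Var [1..<Suc i]) \<and> u \<in> carrier M}"
  have S: "?S \<subseteq> \<phi> ` supported ?C"
  proof
    fix x assume "x \<in> ?S"
    then obtain f u where fu: "f \<in> set (map Var [1..<Suc i])" "u \<in> carrier M" "x = f \<odot>\<^bsub>M\<^esub> u"
      by blast
    then obtain j where "f = Var j" "j \<in> {1..i}"
      by (auto simp: less_Suc_eq_le simp del: upt_Suc)
    with fu obtain p where j: "j \<in> {1..i}" "p \<in> supported B" "x = \<phi> (restriction B (Var j * p))"
      by (auto simp: M_simps)
    have "Var j * p \<in> supported {b. Poly_Mapping.lookup b j \<noteq> 0}"
      by (rule supported_mult[of _ "{Poly_Mapping.single j 1}" p B])
        (auto simp: Var_def lookup_add j supported_single)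
    then have "restriction B (Var j * p) \<in> supported (B \<inter> {b. Poly_Mapping.lookup b j \<noteq> 0})"
      by (rule restriction_in_supported)
    with j show "x \<in> \<phi> ` supported ?C"
      by (auto simp: phi_in_image elim!: supported_mono)
  qed
  have "LinearCombinations.submodule (poly_ring N) (\<phi> ` supported ?C) M"
    by (rule submodule_phi) (auto simp: lookup_add)
  from span_is_subset[OF S this] have "span ?S \<subseteq> \<phi> ` supported ?C" .
  moreover have "\<phi> ` supported ?C \<subseteq> span ?S"
  proof (rule phi_supported_subset_span)
    have "\<phi> ` supported ?C \<subseteq> carrier M"
      by (auto simp: M_simps phi_in_image elim: supported_mono)
    with S show "?S \<subseteq> carrier M" by (rule subset_trans)
    fix b c assume "b \<in> ?C"
    then obtain j where j: "b \<in> B" "j \<in> {1..i}" "Poly_Mapping.lookup b j \<noteq> 0" by auto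
    define b' where "b' = b - Poly_Mapping.single j 1"
    have b: "b = Poly_Mapping.single j 1 + b'"
      unfolding b'_def by (rule single_add_diff[OF j(3), symmetric])
    have "Poly_Mapping.single j 1 \<in> monomials N"
      using j assms by (auto simp: monomials_def)
    then have b': "b' \<in> B" using b j B_closed by auto
    have "Var j \<odot>\<^bsub>M\<^esub> \<phi> (Poly_Mapping.single b' c) \<in> ?S"
      using j b'
      by (intro CollectI exI[of _ "Var j"] exI[of _ "\<phi> (Poly_Mapping.single b' c)"] conjI refl)
        (auto simp: M_simps phi_in_image supported_single simp del: upt_Suc)
    \<comment> \<open>The product already is a generator, so the scalar asked for by
      \<open>phi_supported_subset_span\<close> is 1.\<close>
    moreover have "\<phi> (Poly_Mapping.single b c) = 1 \<odot>\<^bsub>M\<^esub> (Var j \<odot>\<^bsub>M\<^esub> \<phi> (Poly_Mapping.single b' c))"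
      using j b by (simp add: M_simps Var_def mult_single restriction_id supported_single)
    ultimately show "\<exists>a u. a \<in> carrier (poly_ring N) \<and> u \<in> ?S \<and>
        \<phi> (Poly_Mapping.single b c) = a \<odot>\<^bsub>M\<^esub> u"
      by (intro exI[of _ 1] exI[of _ "Var j \<odot>\<^bsub>M\<^esub> \<phi> (Poly_Mapping.single b' c)"] conjI)
        (simp_all only: carrier_poly_ring supported_one)
  qed
  ultimately show ?thesis by (simp add: list_smult_def)
qed

text \<open>By \<open>free\<close>, multiplication by any of \<open>x_1, ..., x_d\<close> merely
  shifts exponents within \<open>B\<close>, so no term is lost. The monomial \<open>b\<close> in
  \<open>base\<close> survives modulo all these variables, so the last quotient is nonzero.\<close>

lemma regular_sequence_variables:
  assumes "d \<le> N"
    and free: "\<And>i b. i \<in> {1..d} \<Longrightarrow> b \<in> B \<Longrightarrow> Poly_Mapping.single i 1 + b \<in> B"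
    and base: "b \<in> B" "\<And>i. i \<in> {1..d} \<Longrightarrow> Poly_Mapping.lookup b i = 0"
  shows "regular_sequence (poly_ring N) M (map Var [1..<Suc d])"
  unfolding regular_sequence_def
proof (intro conjI allI impI)
  show "set (map Var [1..<Suc d]) \<subseteq> carrier (poly_ring N :: 'k mpoly ring)"
    using assms(1) by (auto simp: carrier_poly_ring intro!: Var_in_poly_ring)
next
  have "\<phi> (Poly_Mapping.single b 1) \<in> carrier M"
    by (simp add: M_simps phi_in_image supported_single base)
  moreover have "\<phi> (Poly_Mapping.single b 1) \<notin> list_smult (poly_ring N) (map Var [1..<Suc d]) M"
    unfolding list_smult_variables[OF assms(1)] using base by (auto simp: phi_in_image supported_def)
  ultimately show "list_smult (poly_ring N) (map Var [1..<Suc d]) M \<noteq> carrier M" by auto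
next
  fix i assume i: "i < length (map Var [1..<Suc d] :: 'k mpoly list)"
  then have "i < d" by (simp del: upt_Suc)
  let ?C = "{b \<in> B. \<exists>j\<in>{1..i}. Poly_Mapping.lookup b j \<noteq> 0}"
  let ?Q = "quotient_module M (\<phi> ` supported ?C)"
  \<comment> \<open>List positions start at 0: entry \<open>i\<close> is \<open>x_(i+1)\<close>,
    tested modulo \<open>x_1, ..., x_i\<close>.\<close>
  have take: "take i (map Var [1..<Suc d]) = map Var [1..<Suc i]"
    using \<open>i < d\<close> by (simp add: take_map del: upt_Suc)
  have nth: "map Var [1..<Suc d] ! i = Var (Suc i)"
    using \<open>i < d\<close> by (simp del: upt_Suc)
  have "regular_element ?Q (Var (Suc i))"
    unfolding regular_element_def
  proof (intro ballI impI)
    fix u assume "u \<in> carrier ?Q" and zero: "Var (Suc i) \<odot>\<^bsub>?Q\<^esub> u = \<zero>\<^bsub>?Q\<^esub>"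
    then obtain p where p: "p \<in> supported B" "u = \<phi> ` supported ?C +>\<^bsub>M\<^esub> \<phi> p"
      by (auto simp: quotient_module_def A_RCOSETS_def RCOSETS_def a_r_coset_def M_simps)
    have "Var (Suc i) * p \<in> supported B"
      by (rule supported_mult[of _ "{Poly_Mapping.single (Suc i) 1}" p B])
        (use p free \<open>i < d\<close> in \<open>auto simp: Var_def supported_single\<close>)
    then have restr: "restriction B (Var (Suc i) * p) = Var (Suc i) * p"
      by (rule restriction_id)
    \<comment> \<open>A scalar multiple of a coset is a union over its elements; the representative
      \<open>\<phi> p\<close> suffices to place \<open>x_(i+1) p\<close> in the submodule.\<close>
    have "\<phi> p \<in> u"
      unfolding p coset_phi by (rule image_eqI[of _ _ 0]) auto
    moreover have "\<phi> (Var (Suc i) * p) \<in> \<phi> ` supported ?C +>\<^bsub>M\<^esub> (Var (Suc i) \<odot>\<^bsub>M\<^esub> \<phi> p)"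
      unfolding M_simps restr coset_phi by (rule image_eqI[of _ _ 0]) auto
    ultimately have "\<phi> (Var (Suc i) * p) \<in> Var (Suc i) \<odot>\<^bsub>?Q\<^esub> u"
      by (auto simp: quotient_module_def)
    moreover have "\<zero>\<^bsub>?Q\<^esub> = \<phi> ` supported ?C"
      by (simp add: quotient_module_def)
    ultimately have "Var (Suc i) * p \<in> supported ?C"
      by (simp only: zero phi_in_image)
    then have prod: "a \<in> ?C" if "Poly_Mapping.lookup (Var (Suc i) * p) a \<noteq> 0" for a
      using that supportedD by blast
    have "p \<in> supported ?C"
    proof (rule supportedI)
      fix a assume a: "Poly_Mapping.lookup p a \<noteq> 0"
      \<comment> \<open>Multiplying by \<open>x_(i+1)\<close> does not alter the exponents at
        \<open>1, ..., i\<close>, so a positive one among them already occurs in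
        \<open>a\<close>.\<close>
      then have "Poly_Mapping.single (Suc i) 1 + a \<in> ?C"
        by (intro prod) (simp add: Var_def mult_single_lookup_plus)
      moreover have "a \<in> B" using a p supportedD by blast
      ultimately show "a \<in> ?C" by (auto simp: lookup_add lookup_single when_def)
    qed
    then have "u = \<phi> ` supported ?C"
      unfolding p coset_phi
    proof (intro equalityI subsetI)
      fix x assume "x \<in> \<phi> ` supported ?C" "p \<in> supported ?C"
      then show "x \<in> (\<lambda>q. \<phi> (q + p)) ` supported ?C"
        by (auto intro!: image_eqI[of _ _ "_ - p"] supported_diff)
    qed (auto intro: supported_add)
    then show "u = \<zero>\<^bsub>?Q\<^esub>" by (simp add: quotient_module_def)
  qed
  then show "regular_element (quotient_module M (list_smult (poly_ring N)
      (take i (map Var [1..<Suc d])) M)) (map Var [1..<Suc d] ! i)"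
    unfolding take nth using list_smult_variables[of i] \<open>i < d\<close> assms(1) by simp
qed

lemma depth_M_ge:
  assumes "d \<le> N"
    and "\<And>i b. i \<in> {1..d} \<Longrightarrow> b \<in> B \<Longrightarrow> Poly_Mapping.single i 1 + b \<in> B"
    and "b \<in> B" "\<And>i. i \<in> {1..d} \<Longrightarrow> Poly_Mapping.lookup b i = 0"
  shows "depth N M \<ge> enat d"
proof -
  have "set (map Var [1..<Suc d]) \<subseteq> (max_ideal N :: 'k mpoly set)"
    using assms(1) by (auto simp: max_ideal_def genideal_def)
  moreover have "regular_sequence (poly_ring N) M (map Var [1..<Suc d])"
    using assms by (rule regular_sequence_variables)
  ultimately show ?thesis
    unfolding depth_def
    by (intro Sup_upper CollectI exI[of _ "map Var [1..<Suc d]"]) (auto simp del: upt_Suc)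
qed

end

section \<open>Quotients by monomial ideals\<close>

lemma ideal_supported:
  assumes J: "J \<subseteq> monomials N" "\<And>a b. a \<in> monomials N \<Longrightarrow> b \<in> J \<Longrightarrow> a + b \<in> J"
  shows "ideal (supported J :: 'k::field mpoly set) (poly_ring N)"
proof -
  interpret R: cring "poly_ring N :: 'k mpoly ring" by (rule cring_poly_ring)
  have closed: "p \<in> supported (monomials N)" if "p \<in> supported J" for p :: "'k mpoly"
    using that J(1) by (rule supported_mono)
  show ?thesis
  proof (rule idealI)
    show "subgroup (supported J) (add_monoid (poly_ring N :: 'k mpoly ring))"
    proof (intro group.subgroupI R.a_group)
      fix p :: "'k mpoly" assume p: "p \<in> supported J"
      then have "\<ominus>\<^bsub>poly_ring N\<^esub> p = - p"
        by (intro R.minus_equality)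
          (auto simp: poly_ring_simps carrier_poly_ring closed supported_uminus)
      with p show "inv\<^bsub>add_monoid (poly_ring N)\<^esub> p \<in> supported J"
        by (simp add: a_inv_def supported_uminus)
    qed (auto simp: carrier_poly_ring poly_ring_simps closed supported_add intro: supported_zero)
    fix p q :: "'k mpoly" assume p: "p \<in> supported J" and q: "q \<in> carrier (poly_ring N)"
    then show "q \<otimes>\<^bsub>poly_ring N\<^esub> p \<in> supported J"
      unfolding poly_ring_simps carrier_poly_ring by (intro supported_mult[of q _ p]) (auto intro: J)
    then show "p \<otimes>\<^bsub>poly_ring N\<^esub> q \<in> supported J"
      by (simp add: poly_ring_simps mult.commute)
  qed (rule R.ring_axioms)
qed

lemma genideal_monomials:
  assumes E: "E \<subseteq> monomials N"
  shows "Idl\<^bsub>poly_ring N\<^esub> ((\<lambda>e. Poly_Mapping.single e 1) ` E) =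
    (supported {a + e | a e. a \<in> monomials N \<and> e \<in> E} :: 'k::field mpoly set)"
    (is "Idl\<^bsub>_\<^esub> ?S = supported ?J")
proof
  have "ideal (supported ?J :: 'k mpoly set) (poly_ring N)"
  proof (rule ideal_supported)
    show "a + b \<in> ?J" if "a \<in> monomials N" "b \<in> ?J" for a b
      using that monomials_add_iff by (auto simp: add.assoc[symmetric]) blast
  qed (use E in \<open>auto simp: monomials_add_iff\<close>)
  moreover have "?S \<subseteq> (supported ?J :: 'k mpoly set)"
  proof
    fix x :: "'k mpoly" assume "x \<in> ?S"
    then obtain e where "e \<in> E" "x = Poly_Mapping.single e 1" by auto
    moreover from this have "e \<in> ?J"
      by (intro CollectI exI[of _ 0] exI[of _ e]) auto
    ultimately show "x \<in> supported ?J"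
      by (simp only: supported_single)
  qed
  ultimately show "Idl\<^bsub>poly_ring N\<^esub> ?S \<subseteq> (supported ?J :: 'k mpoly set)"
    by (auto simp: genideal_def)
  show "supported ?J \<subseteq> Idl\<^bsub>poly_ring N\<^esub> (?S :: 'k mpoly set)"
    unfolding genideal_def
  proof (intro subsetI InterI)
    fix p :: "'k mpoly" and I assume "I \<in> {I. ideal I (poly_ring N) \<and> ?S \<subseteq> I}"
    then have I: "ideal I (poly_ring N)" and S: "?S \<subseteq> I" by auto
    interpret I: ideal I "poly_ring N" by (rule I)
    assume "p \<in> supported ?J"
    then show "p \<in> I"
    proof (induction rule: supported_induct)
      case zero
      then show ?case using additive_subgroup.zero_closed[OF I.additive_subgroup_axioms] by (simp add: poly_ring_simps)
    next
      case (add b c p)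
      then obtain a e where ae: "a \<in> monomials N" "e \<in> E" "b = a + e" by auto
      then have "Poly_Mapping.single a c \<otimes>\<^bsub>poly_ring N\<^esub> Poly_Mapping.single e 1 \<in> I"
        using S by (intro I.I_l_closed) (auto simp: carrier_poly_ring supported_single)
      then have "Poly_Mapping.single b c \<in> I"
        by (simp add: poly_ring_simps mult_single ae)
      with add show ?case using additive_subgroup.a_closed[OF I.additive_subgroup_axioms]
        by (simp add: poly_ring_simps)
    qed
  qed
qed

section \<open>Cosets modulo a span of monomials\<close>

lemma coset_self_module:
  "supported J +>\<^bsub>self_module (poly_ring N)\<^esub> p = (\<lambda>q. q + p) ` supported J"
  by (auto simp: a_r_coset_def r_coset_def self_module_def poly_ring_simps)

lemma set_add_self_module:
  "A <+>\<^bsub>self_module (poly_ring N)\<^esub> C = {a + c | a c. a \<in> A \<and> c \<in> C}"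
  by (auto simp: set_add_def set_mult_def self_module_def poly_ring_simps)

lemma coset_self_module_eq:
  fixes p q :: "'k::field mpoly"
  shows "supported J +>\<^bsub>self_module (poly_ring N)\<^esub> p = supported J +>\<^bsub>self_module (poly_ring N)\<^esub> q
    \<longleftrightarrow> p - q \<in> supported J"
  unfolding coset_self_module
proof
  assume "(\<lambda>x. x + p) ` supported J = (\<lambda>x. x + q) ` supported J"
  moreover have "p \<in> (\<lambda>x. x + p) ` supported J"
    by (rule image_eqI[of _ _ 0]) auto
  ultimately show "p - q \<in> supported J" by auto
next
  assume pq: "p - q \<in> supported J"
  have "x + p \<in> (\<lambda>x. x + q) ` supported J" if "x \<in> supported J" for x
    by (rule image_eqI[of _ _ "x + (p - q)"]) (use that pq supported_add in auto)
  moreover have "x + q \<in> (\<lambda>x. x + p) ` supported J" if "x \<in> supported J" for x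
    by (rule image_eqI[of _ _ "x - (p - q)"]) (use that pq supported_diff in auto)
  ultimately show "(\<lambda>x. x + p) ` supported J = (\<lambda>x. x + q) ` supported J" by auto
qed

text \<open>The coset of a homogeneous polynomial has exactly one representative without terms in
  \<open>J\<close>, so the monomials of degree \<open>d\<close> outside \<open>J\<close> give a
  basis.\<close>

lemma dim_quotient_component:
  fixes N :: nat and J :: "(nat \<Rightarrow>\<^sub>0 nat) set"
  defines "S \<equiv> self_module (poly_ring N :: 'k::field mpoly ring)"
    and "F \<equiv> \<lambda>d. {a \<in> monomials N - J. int (total_degree a) = d}"
  assumes fin: "finite (F d)"
  shows "vectorspace.dim class_ring (component (quotient_module S (supported J))
    (quotient_grading S (homogeneous_part N) (supported J)) d) = card (F d)"
proof (rule dim_monomial_basis[OF fin, of _ "\<lambda>p. supported J +>\<^bsub>S\<^esub> p"])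
  let ?V = "component (quotient_module S (supported J))
    (quotient_grading S (homogeneous_part N) (supported J)) d"
  have F_subset: "F d \<subseteq> {a \<in> monomials N. int (total_degree a) = d}"
    by (auto simp: F_def)
  show "carrier ?V = (\<lambda>p. supported J +>\<^bsub>S\<^esub> p) ` supported (F d)"
  proof -
    have "\<exists>q\<in>supported (F d). supported J +>\<^bsub>S\<^esub> p = supported J +>\<^bsub>S\<^esub> q"
      if p: "p \<in> supported {a \<in> monomials N. int (total_degree a) = d}" for p
    proof
      show "restriction (F d) p \<in> supported (F d)" by (rule restriction_supported)
      have "p - restriction (F d) p \<in> supported J"
      proof (rule supportedI)
        show "a \<in> J" if "Poly_Mapping.lookup (p - restriction (F d) p) a \<noteq> 0" for a
          using that supportedD[OF p, of a]
          by (auto simp: lookup_minus lookup_restriction F_def split: if_splits)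
      qed
      then show "supported J +>\<^bsub>S\<^esub> p = supported J +>\<^bsub>S\<^esub> restriction (F d) p"
        by (simp add: S_def coset_self_module_eq)
    qed
    then show ?thesis
      using F_subset by (auto simp: component_def quotient_grading_def homogeneous_part_eq image_iff
          intro: supported_mono)
  qed
  show "inj_on (\<lambda>p. supported J +>\<^bsub>S\<^esub> p) (supported (F d))"
  proof (rule inj_onI)
    fix p q assume "p \<in> supported (F d)" "q \<in> supported (F d)"
      and "supported J +>\<^bsub>S\<^esub> p = supported J +>\<^bsub>S\<^esub> q"
    then have "p - q \<in> supported (F d)" "p - q \<in> supported J"
      by (auto simp: S_def coset_self_module_eq supported_diff)
    then have "Poly_Mapping.keys (p - q) \<subseteq> F d \<inter> J" by (auto simp: supported_def)
    moreover have "F d \<inter> J = {}" by (auto simp: F_def)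
    ultimately have "Poly_Mapping.keys (p - q) = {}" by blast
    then show "p = q" by simp
  qed
  show "\<zero>\<^bsub>?V\<^esub> = supported J +>\<^bsub>S\<^esub> 0"
    by (simp add: component_def quotient_module_def S_def coset_self_module)
next
  fix p q :: "'k mpoly"
  have "set_add S (supported J +>\<^bsub>S\<^esub> p) (supported J +>\<^bsub>S\<^esub> q) = supported J +>\<^bsub>S\<^esub> (p + q)"
  proof (intro equalityI subsetI)
    fix x assume "x \<in> set_add S (supported J +>\<^bsub>S\<^esub> p) (supported J +>\<^bsub>S\<^esub> q)"
    then obtain a b where "a \<in> supported J" "b \<in> supported J" "x = (a + p) + (b + q)"
      by (auto simp: S_def coset_self_module set_add_self_module)
    then show "x \<in> supported J +>\<^bsub>S\<^esub> (p + q)"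
      unfolding S_def coset_self_module
      by (intro image_eqI[of _ _ "a + b"]) (auto simp: supported_add algebra_simps)
  next
    fix x assume "x \<in> supported J +>\<^bsub>S\<^esub> (p + q)"
    then obtain a where a: "a \<in> supported J" "x = (a + p) + (0 + q)"
      by (auto simp: S_def coset_self_module algebra_simps)
    then show "x \<in> set_add S (supported J +>\<^bsub>S\<^esub> p) (supported J +>\<^bsub>S\<^esub> q)"
      using supported_zero[of J] unfolding S_def coset_self_module set_add_self_module by blast
  qed
  then show "(supported J +>\<^bsub>S\<^esub> p) \<oplus>\<^bsub>component (quotient_module S (supported J))
    (quotient_grading S (homogeneous_part N) (supported J)) d\<^esub> (supported J +>\<^bsub>S\<^esub> q) =
      supported J +>\<^bsub>S\<^esub> (p + q)"
    by (simp add: component_def quotient_module_def)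
next
  fix c and p :: "'k mpoly"
  \<comment> \<open>Scalar multiplication of a coset is a union over representatives; all of them
    give the same coset.\<close>
  have const: "supported J +>\<^bsub>S\<^esub> (Const c * v) = supported J +>\<^bsub>S\<^esub> (Const c * p)"
    if "v \<in> supported J +>\<^bsub>S\<^esub> p" for v
    using that by (auto simp: S_def coset_self_module_eq coset_self_module[of N J p]
        right_diff_distrib[symmetric] Const_mult_supported)
  have "p \<in> supported J +>\<^bsub>S\<^esub> p"
    unfolding S_def coset_self_module by (rule image_eqI[of _ _ 0]) auto
  then have "supported J +>\<^bsub>S\<^esub> p \<noteq> {}" by blast
  then have "(\<Union>v\<in>supported J +>\<^bsub>S\<^esub> p. supported J +>\<^bsub>S\<^esub> (Const c * v)) =
      supported J +>\<^bsub>S\<^esub> (Const c * p)"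
    by (rule SUP_eq_const) (rule const)
  then show "c \<odot>\<^bsub>component (quotient_module S (supported J))
    (quotient_grading S (homogeneous_part N) (supported J)) d\<^esub> (supported J +>\<^bsub>S\<^esub> p) =
      supported J +>\<^bsub>S\<^esub> (Const c * p)"
    by (simp add: component_def quotient_module_def S_def self_module_def poly_ring_simps)
qed

text \<open>The generators are squarefree, so divisibility by one of them only asks for positive
  exponents.\<close>

lemma I_ideal_eq:
  assumes "r \<ge> 2" 
  shows "I_ideal n r = (supported {a \<in> monomials (n + r - 1).
    (\<forall>j\<in>{1..r-1}. Poly_Mapping.lookup a j \<noteq> 0) \<and> (\<exists>i\<in>{r..r+n-1}. Poly_Mapping.lookup a i \<noteq> 0)}
    :: 'k::field mpoly set)"
proof -
  define g where "g = (\<lambda>i. (\<Sum>j=1..r-1. Poly_Mapping.single j (1 :: nat)) + Poly_Mapping.single i 1)"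
  \<comment> \<open>Since \<open>i \<ge> r\<close>, the last variable differs from
    \<open>x_1, ..., x_(r-1)\<close>, and no exponent exceeds 1.\<close>
  have lookup_g: "Poly_Mapping.lookup (g i) x = (if x \<in> insert i {1..r-1} then 1 else 0)"
    if "i \<in> {r..r+n-1}" for i x
    using that assms by (auto simp: g_def lookup_add lookup_sum lookup_single when_def)
  have g_mon: "g i \<in> monomials (n + r - 1)" if "i \<in> {r..r+n-1}" for i
    using that assms lookup_g[OF that] by (auto simp: monomials_def in_keys_iff split: if_splits)
  have prod: "(\<Prod>j\<in>A. Var j) = (Poly_Mapping.single (\<Sum>j\<in>A. Poly_Mapping.single j 1) 1 :: 'k mpoly)"
    if "finite A" for A
    using that by induction (auto simp: Var_def mult_single)
  have gens: "{(\<Prod>j=1..r-1. Var j) * Var i | i. i \<in> {r..r+n-1}} =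
      (\<lambda>e. Poly_Mapping.single e (1 :: 'k)) ` (g ` {r..r+n-1})"
  proof -
    have "(\<Prod>j=1..r-1. Var j) * Var i = Poly_Mapping.single (g i) (1 :: 'k)" for i
      unfolding g_def prod[OF finite_atLeastAtMost] by (simp add: Var_def mult_single)
    then show ?thesis unfolding image_image by auto
  qed
  have multiples: "{a + e | a e. a \<in> monomials (n + r - 1) \<and> e \<in> g ` {r..r+n-1}} =
    {a \<in> monomials (n + r - 1).
      (\<forall>j\<in>{1..r-1}. Poly_Mapping.lookup a j \<noteq> 0) \<and> (\<exists>i\<in>{r..r+n-1}. Poly_Mapping.lookup a i \<noteq> 0)}"
    (is "?A = ?B")
  proof (intro equalityI subsetI)
    fix x assume "x \<in> ?A"
    then obtain a i where a: "a \<in> monomials (n + r - 1)" "i \<in> {r..r+n-1}" "x = a + g i" by auto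
    then show "x \<in> ?B"
      using g_mon[of i] lookup_g[of i] by (auto simp: monomials_add_iff lookup_add intro!: bexI[of _ i])
  next
    fix x assume "x \<in> ?B"
    then obtain i where i: "x \<in> monomials (n + r - 1)" "i \<in> {r..r+n-1}"
      "\<forall>j\<in>insert i {1..r-1}. Poly_Mapping.lookup x j \<noteq> 0" by auto
    have "x = (x - g i) + g i"
      using i(3) by (intro poly_mapping_eqI) (auto simp: lookup_add lookup_minus lookup_g[OF i(2)])
    moreover from this have "x - g i \<in> monomials (n + r - 1)"
      using i(1) monomials_add_iff by metis
    ultimately show "x \<in> ?A" using i(2) by blast
  qed
  have "g ` {r..r+n-1} \<subseteq> monomials (n + r - 1)" using g_mon by auto
  from genideal_monomials[OF this] show ?thesis
    unfolding I_ideal_def gens multiples[symmetric] .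
qed

section \<open>Hilbert functions and their decompositions\<close>

definition graded_monomials :: "nat \<Rightarrow> int \<Rightarrow> (nat \<Rightarrow>\<^sub>0 nat) set" where
  "graded_monomials k e = {a \<in> monomials k. int (total_degree a) = e}"

text \<open>The Hilbert function of \<open>K[x_1, ..., x_k]\<close>, with generating function
  \<open>1 / (1 - t)^k\<close>. Integer degrees let shifts run below 0, where it vanishes.\<close>

definition hilb :: "nat \<Rightarrow> int \<Rightarrow> int" where
  "hilb k e = int (card (graded_monomials k e))"

lemma graded_monomials_neg: "e < 0 \<Longrightarrow> graded_monomials k e = {}"
  by (auto simp: graded_monomials_def)

lemma graded_monomials_0: "graded_monomials k 0 = {0}"
proof -
  have "a = 0" if "total_degree a = 0" for a
    using that by (intro poly_mapping_eqI) (auto simp: total_degree_def in_keys_iff)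
  moreover have "total_degree 0 = 0" by (simp add: total_degree_def)
  ultimately show ?thesis by (auto simp: graded_monomials_def)
qed

lemma monomials_Suc_iff:
  "a \<in> monomials k \<longleftrightarrow> a \<in> monomials (Suc k) \<and> Poly_Mapping.lookup a (Suc k) = 0"
proof (cases "Suc k \<in> Poly_Mapping.keys a")
  case True
  then have "a \<notin> monomials k" by (auto simp: monomials_def)
  with True show ?thesis by (simp add: in_keys_iff)
next
  case False
  then show ?thesis
    by (simp add: monomials_def atLeastAtMostSuc_conv subset_insert in_keys_iff)
qed

lemma graded_monomials_Suc:
  "graded_monomials (Suc k) e = graded_monomials k e \<union>
    (\<lambda>a. Poly_Mapping.single (Suc k) 1 + a) ` graded_monomials (Suc k) (e - 1)" (is "_ = ?A \<union> ?f ` ?B")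
proof (intro equalityI subsetI)
  fix a assume a: "a \<in> graded_monomials (Suc k) e"
  show "a \<in> ?A \<union> ?f ` ?B"
  proof (cases "Poly_Mapping.lookup a (Suc k) = 0")
    case True
    with a show ?thesis by (auto simp: graded_monomials_def monomials_Suc_iff[of a k])
  next
    case False
    define b where "b = a - Poly_Mapping.single (Suc k) 1"
    have ab: "a = ?f b" unfolding b_def by (rule single_add_diff[OF False, symmetric])
    with a have "b \<in> ?B"
      by (auto simp: graded_monomials_def monomials_add_iff total_degree_add total_degree_single)
    with ab show ?thesis by auto
  qed
next
  fix a assume "a \<in> ?A \<union> ?f ` ?B"
  then show "a \<in> graded_monomials (Suc k) e"
    by (auto simp: graded_monomials_def monomials_add_iff total_degree_add total_degree_single)
      (auto simp: monomials_def)
qed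

lemma finite_graded_monomials: "finite (graded_monomials k e)"
proof (induction k arbitrary: e)
  case 0
  have "graded_monomials 0 e \<subseteq> {0}"
    by (auto simp: graded_monomials_def monomials_def)
  then show ?case by (rule finite_subset) simp
next
  case (Suc k)
  \<comment> \<open>The recursion keeps \<open>k + 1\<close> while lowering the degree, hence an
    inner induction on nonnegative degrees.\<close>
  have "finite (graded_monomials (Suc k) (int m))" for m
  proof (induction m)
    case 0
    then show ?case by (simp add: graded_monomials_0)
  next
    case (Suc m)
    then show ?case
      using \<open>\<And>e. finite (graded_monomials k e)\<close> by (subst graded_monomials_Suc) simp
  qed
  then show ?case
    by (metis finite.emptyI graded_monomials_neg nonneg_int_cases not_less)
qed

text \<open>The coefficient form of
  \<open>1 / (1 - t)^(k+1) = 1 / (1 - t)^k + t / (1 - t)^(k+1)\<close>, from which all later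
  decompositions derive.\<close>

lemma hilb_Suc: "hilb (Suc k) e = hilb k e + hilb (Suc k) (e - 1)"
proof -
  let ?f = "\<lambda>a. Poly_Mapping.single (Suc k) 1 + a"
  have "graded_monomials k e \<inter> ?f ` graded_monomials (Suc k) (e - 1) = {}"
    by (auto simp: graded_monomials_def monomials_Suc_iff[of _ k] lookup_add)
  then have "card (graded_monomials (Suc k) e) =
      card (graded_monomials k e) + card (?f ` graded_monomials (Suc k) (e - 1))"
    unfolding graded_monomials_Suc[of k e] by (intro card_Un_disjoint) (auto simp: finite_graded_monomials)
  also have "card (?f ` graded_monomials (Suc k) (e - 1)) = card (graded_monomials (Suc k) (e - 1))"
    by (rule card_image) (auto simp: inj_on_def)
  finally show ?thesis by (simp add: hilb_def)
qed

text \<open>In generating functions: \<open>(1 + t + ... + t^(m-1)) / (1 - t)^k = (1 - t^m) / (1 -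
  t)^(k+1)\<close>.\<close>

lemma hilb_telescope:
  "(\<Sum>i<m. hilb k (e - int i)) = hilb (Suc k) e - hilb (Suc k) (e - int m)"
proof (induction m)
  case (Suc m)
  have "hilb (Suc k) (e - int m) = hilb k (e - int m) + hilb (Suc k) (e - int (Suc m))"
    using hilb_Suc[of k "e - int m"] by (simp add: algebra_simps)
  with Suc show ?case by simp
qed simp

section \<open>Hilbert decompositions with bounded numbers of variables\<close>

definition shifted_hilb_sum :: "(nat \<times> nat) list \<Rightarrow> int \<Rightarrow> int" where
  "shifted_hilb_sum xs e = (\<Sum>(s, k)\<leftarrow>xs. hilb k (e - int s))"

text \<open>A pair \<open>(s, k)\<close> stands for \<open>K[x_1, ..., x_k](-s)\<close>. The bound
  \<open>d \<le> k\<close> lets \<open>x_1, ..., x_d\<close> act injectively on every summand;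
  \<open>k \<le> N\<close> makes it a module over the ring in \<open>N\<close> variables.\<close>

definition hilb_decomposable :: "nat \<Rightarrow> nat \<Rightarrow> (int \<Rightarrow> int) \<Rightarrow> bool" where
  "hilb_decomposable d N f \<longleftrightarrow>
    (\<exists>xs. (\<forall>(s, k)\<in>set xs. d \<le> k \<and> k \<le> N) \<and> f = shifted_hilb_sum xs)"

lemma hilb_decomposable_zero: "hilb_decomposable d N (\<lambda>e. 0)"
  unfolding hilb_decomposable_def
  by (intro exI[of _ "[]"]) (auto simp: shifted_hilb_sum_def)

lemma hilb_decomposable_hilb:
  "d \<le> k \<Longrightarrow> k \<le> N \<Longrightarrow> hilb_decomposable d N (\<lambda>e. hilb k (e - int s))"
  unfolding hilb_decomposable_def
  by (intro exI[of _ "[(s, k)]"]) (auto simp: shifted_hilb_sum_def)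

lemma hilb_decomposable_hilb0: "d \<le> k \<Longrightarrow> k \<le> N \<Longrightarrow> hilb_decomposable d N (hilb k)"
  using hilb_decomposable_hilb[of d k N 0] by simp

lemma hilb_decomposable_add:
  assumes "hilb_decomposable d N f" "hilb_decomposable d N g"
  shows "hilb_decomposable d N (\<lambda>e. f e + g e)"
proof -
  from assms obtain xs ys where "\<forall>(s, k)\<in>set xs. d \<le> k \<and> k \<le> N" "f = shifted_hilb_sum xs"
    "\<forall>(s, k)\<in>set ys. d \<le> k \<and> k \<le> N" "g = shifted_hilb_sum ys"
    unfolding hilb_decomposable_def by blast
  then show ?thesis
    unfolding hilb_decomposable_def
    by (intro exI[of _ "xs @ ys"]) (auto simp: shifted_hilb_sum_def)
qed

lemma hilb_decomposable_shift:
  assumes "hilb_decomposable d N f"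
  shows "hilb_decomposable d N (\<lambda>e. f (e - 1))"
proof -
  from assms obtain xs where xs: "\<forall>(s, k)\<in>set xs. d \<le> k \<and> k \<le> N" "f = shifted_hilb_sum xs"
    unfolding hilb_decomposable_def by blast
  have "f (e - 1) = shifted_hilb_sum (map (\<lambda>(s, k). (Suc s, k)) xs) e" for e
    unfolding xs(2) shifted_hilb_sum_def
    by (induction xs) (auto simp: algebra_simps)
  with xs(1) show ?thesis
    unfolding hilb_decomposable_def
    by (intro exI[of _ "map (\<lambda>(s, k). (Suc s, k)) xs"]) auto
qed

lemma hilb_decomposable_sum:
  "finite A \<Longrightarrow> (\<And>i. i \<in> A \<Longrightarrow> hilb_decomposable d N (f i)) \<Longrightarrow>
    hilb_decomposable d N (\<lambda>e. \<Sum>i\<in>A. f i e)"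
  by (induction A rule: finite_induct) (simp_all add: hilb_decomposable_zero hilb_decomposable_add)

text \<open>Induction on \<open>c\<close>: raising \<open>c\<close> by one adds the single summand
  \<open>t / (1 - t)^(d+c+1)\<close>.\<close>

lemma hilb_decomposable_diff_hilb:
  "d + c \<le> N \<Longrightarrow> hilb_decomposable d N (\<lambda>e. hilb (d + c) e - hilb d e)"
proof (induction c)
  case 0
  then show ?case by (simp add: hilb_decomposable_zero)
next
  case (Suc c)
  have "hilb_decomposable d N
      (\<lambda>e. (hilb (d + c) e - hilb d e) + hilb (Suc (d + c)) (e - 1))"
    using Suc by (intro hilb_decomposable_add hilb_decomposable_shift hilb_decomposable_hilb0) auto
  also have "(\<lambda>e. (hilb (d + c) e - hilb d e) + hilb (Suc (d + c)) (e - 1)) =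
      (\<lambda>e. hilb (d + Suc c) e - hilb d e)"
  proof
    show "(hilb (d + c) e - hilb d e) + hilb (Suc (d + c)) (e - 1) =
        hilb (d + Suc c) e - hilb d e" for e
      using hilb_Suc[of "d + c" e] by simp
  qed
  finally show ?case .
qed

text \<open>With \<open>1 / (1 - t)^d\<close> factored out, the induction on \<open>s\<close> rests
  on \<open>1 / (1 - t)^c - t^(s+1) = 1 / (1 - t)^(c-1) + t (1 / (1 - t)^c - t^s)\<close>;
  \<open>c \<ge> 1\<close> leaves at least \<open>d\<close> variables in the summand split
  off.\<close>

lemma hilb_decomposable_diff_shifted:
  assumes "1 \<le> c" "d + c \<le> N"
  shows "hilb_decomposable d N (\<lambda>e. hilb (d + c) e - hilb d (e - int s))"
proof (induction s)
  case 0
  show ?case using hilb_decomposable_diff_hilb[OF assms(2)] by simp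
next
  case (Suc s)
  from assms(1) obtain c' where c': "c = Suc c'" by (cases c) auto
  have "hilb_decomposable d N
      (\<lambda>e. hilb (d + c') e + (hilb (d + c) (e - 1) - hilb d (e - 1 - int s)))"
    using assms c'
    by (intro hilb_decomposable_add hilb_decomposable_hilb0 hilb_decomposable_shift[OF Suc]) auto
  also have "(\<lambda>e. hilb (d + c') e + (hilb (d + c) (e - 1) - hilb d (e - 1 - int s))) =
      (\<lambda>e. hilb (d + c) e - hilb d (e - int (Suc s)))"
  proof
    show "hilb (d + c') e + (hilb (d + c) (e - 1) - hilb d (e - 1 - int s)) =
        hilb (d + c) e - hilb d (e - int (Suc s))" for e
      using hilb_Suc[of "d + c'" e] by (simp add: c' algebra_simps)
  qed
  finally show ?case .
qed

text \<open>In terms of generating functions, this decomposes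
  \<open>(1 / (1 - t)\<^sup>c \<plusminus> t\<^sup>s (1 - t)\<^sup>j) / (1 - t)\<^sup>d\<close> for \<open>j < c\<close>.  The induction on \<open>j\<close> uses
  \<open>1 / (1 - t)\<^sup>c = 1 / (1 - t)\<^bsup>c-1\<^esup> + t / (1 - t)\<^sup>c\<close> and
  \<open>(1 - t)\<^sup>j = (1 - t)\<^bsup>j-1\<^esup> - t (1 - t)\<^bsup>j-1\<^esup>\<close>; the sign \<open>\<epsilon>\<close> alternates in it.\<close>

lemma hilb_decomposable_signed:
  assumes "\<epsilon> = 1 \<or> \<epsilon> = - 1" "j < c" "j \<le> d" "d + c \<le> N"
  shows "hilb_decomposable d N (\<lambda>e. hilb (d + c) e + \<epsilon> * hilb (d - j) (e - int s))"
  using assms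
proof (induction j arbitrary: c \<epsilon>)
  case 0
  \<comment> \<open>For the sign -1 this is the preceding lemma; for the sign 1 both terms are
    admissible summands.\<close>
  then show ?case
    using hilb_decomposable_diff_shifted[of c d N s]
      hilb_decomposable_add[OF hilb_decomposable_hilb0[of d "d + c" N] hilb_decomposable_hilb[of d d N s]]
    by auto
next
  case (Suc j)
  from Suc.prems(2) obtain c' where c': "c = Suc c'" by (cases c) auto
  have dj: "d - j = Suc (d - Suc j)" using Suc.prems(3) by simp
  have rec: "hilb (d - Suc j) x = hilb (d - j) x - hilb (d - j) (x - 1)" for x
    unfolding dj using hilb_Suc[of "d - Suc j" x] by simp
  \<comment> \<open>The induction hypothesis enters twice: with \<open>c - 1\<close>, which still
    exceeds \<open>j\<close>, and, shifted by one degree, with \<open>c\<close> and the opposite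
    sign.\<close>
  have "hilb_decomposable d N (\<lambda>e. (hilb (d + c') e + \<epsilon> * hilb (d - j) (e - int s)) +
      (hilb (d + c) (e - 1) + (- \<epsilon>) * hilb (d - j) (e - 1 - int s)))"
    using Suc.prems c'
    by (intro hilb_decomposable_add hilb_decomposable_shift[OF Suc.IH[of "- \<epsilon>" c]] Suc.IH) auto
  also have "(\<lambda>e. (hilb (d + c') e + \<epsilon> * hilb (d - j) (e - int s)) +
      (hilb (d + c) (e - 1) + (- \<epsilon>) * hilb (d - j) (e - 1 - int s))) =
      (\<lambda>e. hilb (d + c) e + \<epsilon> * hilb (d - Suc j) (e - int s))"
  proof
    show "(hilb (d + c') e + \<epsilon> * hilb (d - j) (e - int s)) +
        (hilb (d + c) (e - 1) + (- \<epsilon>) * hilb (d - j) (e - 1 - int s)) =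
        hilb (d + c) e + \<epsilon> * hilb (d - Suc j) (e - int s)" for e
      using hilb_Suc[of "d + c'" e] rec[of "e - int s"] Suc.prems(1)
      by (auto simp: c' algebra_simps)
  qed
  finally show ?case .
qed

text \<open>Telescoping turns the difference of the first two terms into \<open>r - 1\<close>
  shifted copies of \<open>hilb (N - 1)\<close>. The unshifted copy is combined with the last term;
  the other copies are admissible summands already.\<close>

lemma hilb_decomposable_quotient:
  fixes n r :: nat
  assumes "n \<ge> 2" "r \<ge> 2"
  defines "N \<equiv> n + r - 1"
  shows "hilb_decomposable (n div 2 + r - 2) N
    (\<lambda>e. hilb N e - hilb N (e - int (r - 1)) + hilb (r - 1) (e - int (r - 1)))"
proof -
  \<comment> \<open>Here \<open>d + c = N - 1\<close> and \<open>d - j = r - 1\<close>. With these,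
    \<open>j < c\<close> amounts to \<open>2 * d \<le> n + 2 * r - 4\<close>, and
    \<open>n div 2 + r - 2\<close> is the largest such \<open>d\<close>.\<close>
  define d c j q where "d = n div 2 + r - 2" and "c = n - n div 2" and "j = n div 2 - 1"
    and "q = r - 1"
  have eqs: "N = Suc (d + c)" "q = d - j" "j < c" "j \<le> d" "0 < q"
    using assms by (auto simp: d_def c_def j_def q_def)
  have "hilb_decomposable d N (\<lambda>e. (hilb (d + c) e + 1 * hilb (d - j) (e - int q)) +
      (\<Sum>i\<in>{1..<q}. hilb (d + c) (e - int i)))"
    using eqs
    by (intro hilb_decomposable_add hilb_decomposable_signed hilb_decomposable_sum hilb_decomposable_hilb)
      auto
  also have "(\<lambda>e. (hilb (d + c) e + 1 * hilb (d - j) (e - int q)) +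
      (\<Sum>i\<in>{1..<q}. hilb (d + c) (e - int i))) =
      (\<lambda>e. hilb N e - hilb N (e - int q) + hilb q (e - int q))"
  proof
    fix e
    have "(\<Sum>i<q. hilb (d + c) (e - int i)) =
        hilb (d + c) e + (\<Sum>i\<in>{1..<q}. hilb (d + c) (e - int i))"
      unfolding lessThan_atLeast0 using \<open>0 < q\<close> by (simp add: sum.atLeast_Suc_lessThan)
    then show "(hilb (d + c) e + 1 * hilb (d - j) (e - int q)) +
        (\<Sum>i\<in>{1..<q}. hilb (d + c) (e - int i)) =
        hilb N e - hilb N (e - int q) + hilb q (e - int q)"
      using hilb_telescope[of "d + c" e q] unfolding eqs(1) eqs(2)[symmetric] by linarith
  qed
  finally show ?thesis by (simp add: d_def q_def)
qed

lemma card_nonmembers: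
  fixes n r :: nat
  assumes "n \<ge> 2" "r \<ge> 2"
  defines "N \<equiv> n + r - 1"
  defines "J \<equiv> {a \<in> monomials N. (\<forall>j\<in>{1..r-1}. Poly_Mapping.lookup a j \<noteq> 0) \<and>
      (\<exists>i\<in>{r..r+n-1}. Poly_Mapping.lookup a i \<noteq> 0)}"
  shows "int (card {a \<in> monomials N - J. int (total_degree a) = e}) =
    hilb N e - hilb N (e - int (r - 1)) + hilb (r - 1) (e - int (r - 1))"
proof -
  define u :: "nat \<Rightarrow>\<^sub>0 nat" where "u = (\<Sum>j=1..r-1. Poly_Mapping.single j 1)"
  have lookup_u: "Poly_Mapping.lookup u x = (if x \<in> {1..r-1} then 1 else 0)" for x
    by (auto simp: u_def lookup_sum lookup_single when_def)
  have u_deg: "total_degree u = r - 1"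
    by (subst total_degree_superset[of "{1..r-1}"])
      (auto simp: lookup_u in_keys_iff split: if_splits)
  have u_mon: "u \<in> monomials N" "u \<in> monomials (r - 1)"
    using assms(2) by (auto simp: monomials_def in_keys_iff lookup_u N_def split: if_splits)
  have "{1..r-1} \<subseteq> {1..N}" by (auto simp: N_def)
  then have sub: "monomials (r - 1) \<subseteq> monomials N"
    unfolding monomials_def by (blast intro: subset_trans)
  \<comment> \<open>Translation by \<open>u\<close> raises the degree by \<open>r - 1\<close> and
    yields the multiples of \<open>u = x_1 ... x_(r-1)\<close> of degree \<open>e\<close>.\<close>
  let ?U = "\<lambda>k. (\<lambda>a. u + a) ` graded_monomials k (e - int (r - 1))"
  have U: "?U k = {a \<in> graded_monomials k e. \<forall>j\<in>{1..r-1}. Poly_Mapping.lookup a j \<noteq> 0}"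
    if u: "u \<in> monomials k" for k
  proof (intro equalityI subsetI)
    fix a assume "a \<in> ?U k"
    then show "a \<in> {a \<in> graded_monomials k e. \<forall>j\<in>{1..r-1}. Poly_Mapping.lookup a j \<noteq> 0}"
      using u by (auto simp: graded_monomials_def monomials_add_iff total_degree_add u_deg lookup_add lookup_u)
  next
    fix a assume a: "a \<in> {a \<in> graded_monomials k e. \<forall>j\<in>{1..r-1}. Poly_Mapping.lookup a j \<noteq> 0}"
    then have eq: "a = u + (a - u)"
      by (intro poly_mapping_eqI) (auto simp: lookup_add lookup_minus lookup_u Suc_leI)
    have "u + (a - u) \<in> graded_monomials k e" using a eq by simp
    then have "a - u \<in> graded_monomials k (e - int (r - 1))"
      by (auto simp: graded_monomials_def monomials_add_iff total_degree_add u_deg)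
    with eq show "a \<in> ?U k" by blast
  qed
  have card_U: "card (?U k) = card (graded_monomials k (e - int (r - 1)))" for k
    by (rule card_image) (auto simp: inj_on_def)
  have zero_iff: "a \<in> monomials (r - 1) \<longleftrightarrow> (\<forall>i\<in>{r..r+n-1}. Poly_Mapping.lookup a i = 0)"
    if "a \<in> monomials N" for a
  proof -
    have "{1..N} = {1..r-1} \<union> {r..r+n-1}" "{1..r-1} \<inter> {r..r+n-1} = {}"
      using assms(2) by (auto simp: N_def)
    moreover have "(\<forall>i\<in>{r..r+n-1}. Poly_Mapping.lookup a i = 0) \<longleftrightarrow>
        Poly_Mapping.keys a \<inter> {r..r+n-1} = {}"
      by (auto simp: in_keys_iff)
    ultimately show ?thesis
      using that unfolding monomials_def by blast
  qed
  \<comment> \<open>Nonmembers are the nonmultiples of \<open>u\<close> and the multiples of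
    \<open>u\<close> in \<open>x_1, ..., x_(r-1)\<close> alone; the two parts are disjoint.\<close>
  have "{a \<in> monomials N - J. int (total_degree a) = e} = (graded_monomials N e - ?U N) \<union> ?U (r - 1)"
    unfolding U[OF u_mon(1)] U[OF u_mon(2)] using sub zero_iff
    by (auto simp: J_def graded_monomials_def)
  moreover have "?U (r - 1) \<subseteq> ?U N"
    using sub by (auto simp: graded_monomials_def)
  moreover have "?U N \<subseteq> graded_monomials N e"
    unfolding U[OF u_mon(1)] by auto
  moreover have "finite (?U k)" for k by (simp add: finite_graded_monomials)
  \<comment> \<open>Cardinalities are subtracted in \<open>nat\<close>; the inequality proved
    alongside makes the passage to \<open>int\<close> exact.\<close>
  ultimately have "card {a \<in> monomials N - J. int (total_degree a) = e} =
      card (graded_monomials N e) - card (?U N) + card (?U (r - 1))" "card (?U N) \<le> card (graded_monomials N e)"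
    by (auto simp: finite_graded_monomials card_Un_disjoint card_Diff_subset Diff_Int_distrib2 card_mono
        disjoint_iff subset_iff)
  then show ?thesis
    using card_U[of N] card_U[of "r - 1"] unfolding hilb_def by linarith
qed

section \<open>The direct sum realising a decomposition\<close>

text \<open>Realises a Hilbert decomposition \<open>(s\<^sub>0, k\<^sub>0), \<dots>\<close> by the direct sum of the modules
  \<open>K[x\<^sub>1, \<dots>, x\<^bsub>k\<^sub>i\<^esub>](-s\<^sub>i)\<close>; the exponent of the additional variable \<open>x\<^sub>0\<close> is the index \<open>i\<close>.\<close>

definition summand_monomials :: "(nat \<times> nat) list \<Rightarrow> (nat \<Rightarrow>\<^sub>0 nat) set" where
  "summand_monomials xs = {a. Poly_Mapping.lookup a 0 < length xs \<and>
    Poly_Mapping.keys a \<subseteq> {0..snd (xs ! Poly_Mapping.lookup a 0)}}"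

text \<open>The exponent of \<open>x_0\<close> is only a label, so it is removed from the total
  degree; the generator \<open>x_0^i\<close> has degree \<open>s_i\<close>.\<close>

definition summand_degree :: "(nat \<times> nat) list \<Rightarrow> (nat \<Rightarrow>\<^sub>0 nat) \<Rightarrow> int" where
  "summand_degree xs a = int (fst (xs ! Poly_Mapping.lookup a 0)) + int (total_degree a)
    - int (Poly_Mapping.lookup a 0)"

lemma monomials_lookup_0: "a \<in> monomials k \<Longrightarrow> Poly_Mapping.lookup a 0 = 0"
  using in_keys_iff[of 0 a] by (auto simp: monomials_def)

lemma summand_monomials_split:
  assumes "a \<in> summand_monomials xs"
  obtains b i where "a = Poly_Mapping.single 0 i + b" "i < length xs" "b \<in> monomials (snd (xs ! i))"
proof
  let ?i = "Poly_Mapping.lookup a 0" and ?b = "a - Poly_Mapping.single 0 (Poly_Mapping.lookup a 0)"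
  show "a = Poly_Mapping.single 0 ?i + ?b"
    by (rule poly_mapping_eqI) (auto simp: lookup_add lookup_minus lookup_single when_def)
  show "?i < length xs" using assms by (simp add: summand_monomials_def)
  have "x \<in> {1..snd (xs ! ?i)}" if "x \<in> Poly_Mapping.keys ?b" for x
  proof -
    from that have "x \<noteq> 0" "x \<in> Poly_Mapping.keys a"
      by (auto simp: in_keys_iff lookup_minus lookup_single when_def split: if_splits)
    then have "x \<le> snd (xs ! ?i)"
      using assms by (auto simp: summand_monomials_def)
    with \<open>x \<noteq> 0\<close> show ?thesis by simp
  qed
  then show "?b \<in> monomials (snd (xs ! ?i))" by (auto simp: monomials_def)
qed

lemma summand_monomials_single_add:
  assumes "b \<in> monomials k" "i < length xs"
  shows "Poly_Mapping.single 0 i + b \<in> summand_monomials xs \<longleftrightarrow> b \<in> monomials (snd (xs ! i))"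
proof -
  have lookup: "Poly_Mapping.lookup (Poly_Mapping.single 0 i + b) 0 = i"
    using assms(1) by (simp add: lookup_add monomials_lookup_0)
  have "0 \<notin> Poly_Mapping.keys b" using monomials_lookup_0[OF assms(1)] by (simp add: in_keys_iff)
  then have "Poly_Mapping.keys b \<subseteq> {0..m} \<longleftrightarrow> Poly_Mapping.keys b \<subseteq> {1..m}" for m
    by (metis One_nat_def atLeast0AtMost atLeastAtMost_insertL insert_absorb2 le0 subset_insert)
  then show ?thesis
    using assms(2) by (auto simp: summand_monomials_def lookup keys_add_nat monomials_def)
qed

lemma summand_degree_single_add:
  "b \<in> monomials k \<Longrightarrow>
    summand_degree xs (Poly_Mapping.single 0 i + b) = int (fst (xs ! i)) + int (total_degree b)"
  by (simp add: summand_degree_def lookup_add monomials_lookup_0 total_degree_add total_degree_single)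

lemma summand_monomials_degree_eq:
  "{a \<in> summand_monomials xs. summand_degree xs a = e} =
    (\<Union>i<length xs. (\<lambda>b. Poly_Mapping.single 0 i + b) `
      graded_monomials (snd (xs ! i)) (e - int (fst (xs ! i))))" (is "?A = ?B")
proof (intro equalityI subsetI)
  fix a assume a: "a \<in> ?A"
  then obtain b i where bi: "a = Poly_Mapping.single 0 i + b" "i < length xs"
      "b \<in> monomials (snd (xs ! i))"
    using summand_monomials_split by blast
  with a have "b \<in> graded_monomials (snd (xs ! i)) (e - int (fst (xs ! i)))"
    by (simp add: graded_monomials_def summand_degree_single_add)
  with bi show "a \<in> ?B" by blast
next
  fix a assume "a \<in> ?B"
  then show "a \<in> ?A"
    by (auto simp: graded_monomials_def summand_degree_single_add summand_monomials_single_add)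
qed

lemma finite_summand_monomials_degree: "finite {a \<in> summand_monomials xs. summand_degree xs a = e}"
  unfolding summand_monomials_degree_eq by (simp add: finite_graded_monomials)

text \<open>The exponent of \<open>x_0\<close> recovers the index, so the contributions of different
  summands are disjoint and add up.\<close>

lemma card_summand_monomials_degree:
  "int (card {a \<in> summand_monomials xs. summand_degree xs a = e}) = shifted_hilb_sum xs e"
proof -
  let ?C = "\<lambda>i. (\<lambda>b. Poly_Mapping.single 0 i + b) `
      graded_monomials (snd (xs ! i)) (e - int (fst (xs ! i)))"
  have index: "Poly_Mapping.lookup a 0 = i" if "a \<in> ?C i" for a i
    using that by (auto simp: graded_monomials_def lookup_add monomials_lookup_0)
  have "?C i \<inter> ?C j = {}" if "i \<noteq> j" for i j
  proof (rule equals0I)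
    fix a assume "a \<in> ?C i \<inter> ?C j"
    from index[OF IntD1[OF this]] index[OF IntD2[OF this]] that show False by simp
  qed
  then have "card (\<Union>i<length xs. ?C i) = (\<Sum>i<length xs. card (?C i))"
    by (intro card_UN_disjoint) (simp_all add: finite_graded_monomials)
  also have "\<dots> = (\<Sum>i<length xs. card (graded_monomials (snd (xs ! i)) (e - int (fst (xs ! i)))))"
    by (intro sum.cong refl card_image) (simp add: inj_on_def)
  finally show ?thesis
    unfolding summand_monomials_degree_eq shifted_hilb_sum_def
    by (simp add: sum_list_sum_nth hilb_def case_prod_beta atLeast0LessThan)
qed

text \<open>The direct sum given by a decomposition of \<open>f\<close> competes in the supremum
  defining \<open>hdepth\<close>; \<open>x_1, ..., x_d\<close> is regular on it because every
  summand has at least \<open>d\<close> variables.\<close>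

lemma hdepth_ge_hilb_decomposable:
  fixes M :: "('k::field mpoly, 'b) module"
  assumes dec: "hilb_decomposable d N f" and "d \<le> N" and "f e \<noteq> 0"
    and dim: "\<And>e. int (vectorspace.dim class_ring (component M G e)) = f e"
  shows "hdepth N M G \<ge> enat d"
proof -
  from dec obtain xs where xs: "\<And>s k. (s, k) \<in> set xs \<Longrightarrow> d \<le> k \<and> k \<le> N"
    and f: "f = shifted_hilb_sum xs"
    unfolding hilb_decomposable_def by blast
  have k: "d \<le> snd (xs ! i) \<and> snd (xs ! i) \<le> N" if "i < length xs" for i
    using xs[of "fst (xs ! i)" "snd (xs ! i)"] that by simp
  \<comment> \<open>A nonzero value of \<open>f\<close> forces a nonempty list, hence a nonzero
    module; the zero module admits no regular sequence.\<close>
  have "xs \<noteq> []" using \<open>f e \<noteq> 0\<close> by (auto simp: f shifted_hilb_sum_def)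
  \<comment> \<open>Singletons of constant vectors embed the polynomials into the element type fixed
    by \<open>hdepth\<close>.\<close>
  define \<phi> where "\<phi> = (\<lambda>p :: 'k mpoly. {\<lambda>_ :: nat. p})"
  interpret U: monomial_module N "summand_monomials xs" "summand_degree xs" \<phi>
  proof
    show "inj \<phi>" by (auto simp: \<phi>_def inj_def fun_eq_iff)
    fix a b :: "nat \<Rightarrow>\<^sub>0 nat" assume a: "a \<in> monomials N"
    show "b \<in> summand_monomials xs" if "a + b \<in> summand_monomials xs"
      using that a by (auto simp: summand_monomials_def keys_add_nat lookup_add monomials_lookup_0)
    show "summand_degree xs (a + b) = int (total_degree a) + summand_degree xs b"
      using a by (simp add: summand_degree_def lookup_add monomials_lookup_0 total_degree_add)
  qed
  have "finitely_generated (poly_ring N) U.M"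
  proof (rule U.finitely_generated_M)
    \<comment> \<open>One generator per summand: its label alone.\<close>
    let ?E = "Poly_Mapping.single 0 ` {..<length xs}"
    show "finite ?E" by simp
    show "?E \<subseteq> summand_monomials xs"
      by (auto simp: summand_monomials_def split: if_splits)
    fix b assume "b \<in> summand_monomials xs"
    then obtain a i where a: "b = Poly_Mapping.single 0 i + a" "i < length xs"
      "a \<in> monomials (snd (xs ! i))"
      by (rule summand_monomials_split)
    then have "a \<in> monomials N" using k[of i] by (auto simp: monomials_def)
    with a show "\<exists>a\<in>monomials N. \<exists>e\<in>?E. b = a + e" by (auto simp: add.commute)
  qed
  moreover have "hilbert_series U.M U.G = hilbert_series M G"
  proof -
    have "int (vectorspace.dim class_ring (component U.M U.G e)) =
        int (vectorspace.dim class_ring (component M G e))" for e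
      unfolding dim f U.dim_component[OF finite_summand_monomials_degree]
      by (rule card_summand_monomials_degree)
    then show ?thesis by (simp add: hilbert_series_def)
  qed
  ultimately have "depth N U.M \<le> hdepth N M G"
    unfolding hdepth_def using U.graded_module_M by (intro Sup_upper) blast
  moreover have "enat d \<le> depth N U.M"
  proof (rule U.depth_M_ge[OF \<open>d \<le> N\<close>])
    \<comment> \<open>The exponent 0 is the generator of the first summand; as no variable divides
      it, it survives modulo \<open>x_1, ..., x_d\<close>.\<close>
    show "0 \<in> summand_monomials xs" using \<open>xs \<noteq> []\<close> by (simp add: summand_monomials_def)
    fix i b assume "i \<in> {1..d}" "b \<in> summand_monomials xs"
    then show "Poly_Mapping.single i 1 + b \<in> summand_monomials xs"
      using k[of "Poly_Mapping.lookup b 0"]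
      by (auto simp: summand_monomials_def lookup_add lookup_single keys_add_nat)
  qed simp
  ultimately show ?thesis by (rule order_trans[rotated])
qed

theorem theorem2p9:
  fixes n r :: nat
  assumes "n \<ge> 2" and "r \<ge> 2"
  defines "S \<equiv> self_module (poly_ring (n + r - 1) :: 'k::field mpoly ring)"
    and "I \<equiv> (I_ideal n r :: 'k mpoly set)"
  shows "hdepth (n + r - 1) (quotient_module S I)
           (quotient_grading S (homogeneous_part (n + r - 1)) I)
         \<ge> enat (n div 2 + r - 2)"
proof (rule hdepth_ge_hilb_decomposable)
  let ?N = "n + r - 1"
  let ?f = "\<lambda>e. hilb ?N e - hilb ?N (e - int (r - 1)) + hilb (r - 1) (e - int (r - 1))"
  show "hilb_decomposable (n div 2 + r - 2) ?N ?f"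
    using assms(1,2) by (rule hilb_decomposable_quotient)
  show "n div 2 + r - 2 \<le> ?N" by simp
  \<comment> \<open>The value is 1: as \<open>r - 1 \<ge> 1\<close>, both shifted terms are taken in
    negative degree.\<close>
  show "?f 0 \<noteq> 0"
    using assms(2) by (simp add: hilb_def graded_monomials_0 graded_monomials_neg)
  fix e
  let ?J = "{a \<in> monomials ?N. (\<forall>j\<in>{1..r-1}. Poly_Mapping.lookup a j \<noteq> 0) \<and>
      (\<exists>i\<in>{r..r+n-1}. Poly_Mapping.lookup a i \<noteq> 0)}"
  have "finite {a \<in> monomials ?N - ?J. int (total_degree a) = e}"
    by (rule finite_subset[OF _ finite_graded_monomials[of ?N e]]) (auto simp: graded_monomials_def)
  from dim_quotient_component[where 'k = 'k, OF this]
  show "int (vectorspace.dim class_ring (component (quotient_module S I)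
      (quotient_grading S (homogeneous_part ?N) I) e)) = ?f e"
    unfolding S_def I_def I_ideal_eq[OF assms(2)] card_nonmembers[OF assms(1,2), symmetric] by simp
qed

end
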